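(* Let $N\ge 1$, $i\in\langle N\rangle$ and let $u$ be a word over $\langle N\rangle$ with $|u|\ge 2$. Then the antipode $S_{\mathcal L}$ of the left Lagrange Hopf algebra $\mathcal L^N$ satisfies \[ S_{\mathcal L}(Y_u^i)=\sum_{T\in \mathbf{RT}_u^i}(-1)^{\mathbf v(T)}\,\Lambda_{\downarrow\ell}(T). \]
   Context: Let $\langle N\rangle=\{1,\dots,N\}$. For a word $u=u(1)\cdots u(p)$ over $\langle N\rangle$ write $|u|=p$. The interval partition Hopf algebra $\mathcal H=\mathcal H^N$ is, as an algebra, the free unital associative complex algebra on generators $Y_u^i$ ($i\in\langle N\rangle$, $|u|\ge 2$); one sets $Y_j^i=\delta_{ij}1$ for single letters $i,j$. Its counit $\varepsilon$ is the algebra homomorphism with $\varepsilon(Y_u^i)=0$, and its comultiplication is the algebra homomorphism $\Delta:\mathcal H\to\mathcal H\otimes\mathcal H$ with $\Delta(Y_u^i)=\sum_{q=1}^{p}\sum_{(C_1,\dots,C_q)}\sum_{v\in\langle N\rangle^q} Y_{u|C_1}^{v(1)}\cdots Y_{u|C_q}^{v(q)}\otimes Y_v^i$, where $p=|u|$, the middle sum is over all partitions of $\{1,\dots,p\}$ into $q$ nonempty consecutive intervals $C_1<\dots<C_q$, and $u|C_k$ is the subword of $u$ indexed by $C_k$. This is a connected graded bialgebra and has an invertible antipode $S_{\mathcal H}$. The left Lagrange Hopf algebra $\mathcal L^N$ is $\mathcal H$ with the same multiplication and counit, the opposite comultiplication $\Delta^{op}=\tau\circ\Delta$ ($\tau$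 the flip), and antipode $S_{\mathcal L}=S_{\mathcal H}^{-1}$. Trees: a colored planar tree is a finite rooted tree in which the children of each vertex are linearly ordered (left to right) and each vertex $x$ has a color $c(x)\in\langle N\rangle$; trees are taken up to isomorphism preserving root, child orders and colors. A leaf is a vertex with no children. A tree is reduced if every non-leaf vertex has at least two children. $\mathbf{RT}_u^i$ is the set of reduced colored planar trees whose root has color $i$ and whose leaves, read from left to right, have colors $u(1),\dots,u(p)$. For a non-leaf vertex $x$ with children $y_1<\dots<y_k$ put $Y(x)=Y^{c(x)}_{c(y_1)\cdots c(y_k)}\in\mathcal H$. $\mathbf v(T)$ is the number of non-leaf vertices of $T$. $\Lambda_{\downarrow\ell}(T)=Y(x_1)\cdots Y(x_r)$ where $x_1,\dots,x_r$ are the non-leaf vertices of $T$ listed in preorder with children visited from right to left (the root first; after a vertex, the subtrees of its children are traversed from the rightmost child to the leftmost child). (In the paper this is the descending left depth-first order.) *)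

theory Defs
  imports Complex_Main "HOL-Library.Function_Algebras"
begin

text \<open>A generator Y_u^i is encoded as the pair (i, u); colours are natural numbers,
  and the valid generators for a given N are those with colours in {1..N} and |u| >= 2.
  Monomials are lists of generators (free monoid); elements of the free algebra are
  finitely supported functions from monomials to complex coefficients.\<close>

type_synonym gen = "nat \<times> nat list"
type_synonym mon = "gen list"
type_synonym alg = "mon \<Rightarrow> complex"
type_synonym ten = "mon \<times> mon \<Rightarrow> complex"

definition gens :: "nat \<Rightarrow> gen set" where
  "gens N = {(i, u). i \<in> {1..N} \<and> set u \<subseteq> {1..N} \<and> 2 \<le> length u}"

definition supp :: "('a \<Rightarrow> complex) \<Rightarrow> 'a set" where
  "supp f = {x. f x \<noteq> 0}"

definition H :: "nat \<Rightarrow> alg set" where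
  "H N = {f. finite (supp f) \<and> (\<forall>m \<in> supp f. set m \<subseteq> gens N)}"

definition smult :: "complex \<Rightarrow> ('a \<Rightarrow> complex) \<Rightarrow> 'a \<Rightarrow> complex" where
  "smult c f = (\<lambda>x. c * f x)"

definition monom :: "mon \<Rightarrow> alg" where
  "monom m = (\<lambda>x. if x = m then 1 else 0)"

definition one :: alg where
  "one = monom []"

definition splits :: "'a list \<Rightarrow> ('a list \<times> 'a list) set" where
  "splits xs = {(a, b). a @ b = xs}"

definition amult :: "alg \<Rightarrow> alg \<Rightarrow> alg" where
  "amult f g = (\<lambda>m. \<Sum>(a, b) \<in> splits m. f a * g b)"

text \<open>Counit: algebra homomorphism killing all generators = constant coefficient.\<close>
definition eps :: "alg \<Rightarrow> complex" where
  "eps f = f []"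

definition Yel :: "nat \<Rightarrow> nat list \<Rightarrow> alg" where
  "Yel i u = (if length u = 1 then (if u = [i] then one else (\<lambda>_. 0)) else monom [(i, u)])"

definition tens :: "alg \<Rightarrow> alg \<Rightarrow> ten" where
  "tens f g = (\<lambda>(a, b). f a * g b)"

definition tmult :: "ten \<Rightarrow> ten \<Rightarrow> ten" where
  "tmult s t = (\<lambda>(a, b). \<Sum>(a1, a2) \<in> splits a. \<Sum>(b1, b2) \<in> splits b. s (a1, b1) * t (a2, b2))"

definition mu :: "ten \<Rightarrow> alg" where
  "mu t = (\<lambda>m. \<Sum>(a, b) \<in> splits m. t (a, b))"

text \<open>Cutting a word according to a composition (the interval partition C_1 < ... < C_q
  is encoded by the list of the sizes of its blocks).\<close>
fun chop :: "nat list \<Rightarrow> 'a list \<Rightarrow> 'a list list" where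
  "chop [] xs = []"
| "chop (k # ks) xs = take k xs # chop ks (drop k xs)"

definition compositions :: "nat \<Rightarrow> nat \<Rightarrow> nat list set" where
  "compositions p q = {ks. length ks = q \<and> (\<forall>k \<in> set ks. 0 < k) \<and> sum_list ks = p}"

definition words :: "nat \<Rightarrow> nat \<Rightarrow> nat list set" where
  "words N q = {v. length v = q \<and> set v \<subseteq> {1..N}}"

definition Dgen :: "nat \<Rightarrow> gen \<Rightarrow> ten" where
  "Dgen N g = (case g of (i, u) \<Rightarrow>
     (\<Sum>q \<in> {1..length u}. \<Sum>ks \<in> compositions (length u) q. \<Sum>v \<in> words N q.
        tens (foldr amult (map (\<lambda>(j, w). Yel j w) (zip v (chop ks u))) one) (Yel i v)))"

fun Dmon :: "nat \<Rightarrow> mon \<Rightarrow> ten" where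
  "Dmon N [] = tens one one"
| "Dmon N (g # gs) = tmult (Dgen N g) (Dmon N gs)"

definition Delta :: "nat \<Rightarrow> alg \<Rightarrow> ten" where
  "Delta N f = (\<Sum>m \<in> supp f. smult (f m) (Dmon N m))"

definition tmap :: "(alg \<Rightarrow> alg) \<Rightarrow> (alg \<Rightarrow> alg) \<Rightarrow> ten \<Rightarrow> ten" where
  "tmap S T t = (\<Sum>p \<in> supp t. smult (t p) (tens (S (monom (fst p))) (T (monom (snd p)))))"

definition is_antipode :: "nat \<Rightarrow> (alg \<Rightarrow> alg) \<Rightarrow> bool" where
  "is_antipode N S \<longleftrightarrow>
     (\<forall>f \<in> H N. S f \<in> H N) \<and>
     (\<forall>f \<in> H N. \<forall>g \<in> H N. S (f + g) = S f + S g) \<and>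
     (\<forall>f \<in> H N. \<forall>c. S (smult c f) = smult c (S f)) \<and>
     (\<forall>f \<in> H N. mu (tmap S id (Delta N f)) = smult (eps f) one) \<and>
     (\<forall>f \<in> H N. mu (tmap id S (Delta N f)) = smult (eps f) one)"

text \<open>The antipode S_H of H^N (made unique by being zero outside H^N).\<close>
definition S_H :: "nat \<Rightarrow> alg \<Rightarrow> alg" where
  "S_H N = (THE S. is_antipode N S \<and> (\<forall>f. f \<notin> H N \<longrightarrow> S f = 0))"

text \<open>The antipode of the left Lagrange Hopf algebra: S_L = S_H^{-1} (inverse on H^N).\<close>
definition S_L :: "nat \<Rightarrow> alg \<Rightarrow> alg" where
  "S_L N y = (THE x. x \<in> H N \<and> S_H N x = y)"

datatype tree = Node nat "tree list"

fun root :: "tree \<Rightarrow> nat" where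
  "root (Node c ts) = c"

fun colours_ok :: "nat \<Rightarrow> tree \<Rightarrow> bool" where
  "colours_ok N (Node c ts) = (c \<in> {1..N} \<and> (\<forall>t \<in> set ts. colours_ok N t))"

fun reduced :: "tree \<Rightarrow> bool" where
  "reduced (Node c ts) = ((ts = [] \<or> 2 \<le> length ts) \<and> (\<forall>t \<in> set ts. reduced t))"

fun leaves :: "tree \<Rightarrow> nat list" where
  "leaves (Node c []) = [c]"
| "leaves (Node c (t # ts)) = concat (map leaves (t # ts))"

fun nv :: "tree \<Rightarrow> nat" where
  "nv (Node c []) = 0"
| "nv (Node c (t # ts)) = Suc (sum_list (map nv (t # ts)))"

fun lamw :: "tree \<Rightarrow> mon" where
  "lamw (Node c []) = []"
| "lamw (Node c (t # ts)) = (c, map root (t # ts)) # concat (map lamw (rev (t # ts)))"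

definition RT :: "nat \<Rightarrow> nat \<Rightarrow> nat list \<Rightarrow> tree set" where
  "RT N i u = {T. reduced T \<and> colours_ok N T \<and> root T = i \<and> leaves T = u}"

end

theory Submission
  imports Defs
begin

text \<open>
  For words \<open>u\<close>, \<open>v\<close> let \<open>M(u, v)\<close> be the sum of the products \<open>Y\<^sub>1 \<cdots> Y\<^sub>q\<close> of generators over all
  interval partitions of \<open>u\<close> into \<open>q = |v|\<close> blocks, the upper index of \<open>Y\<^sub>k\<close> being the letter \<open>v(k)\<close>
  and its lower index the \<open>k\<close>-th block. Then
  \<open>\<Delta>(Y\<^sub>u\<^sup>i) = \<Sum>\<^sub>v M(u, v) \<otimes> Y\<^sub>v\<^sup>i\<close>, so the antipode equations on generators say that certain matrices
  indexed by words are inverse to each other. Since the antipode reverses products, this extends from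
  one-letter words to all words by telescoping.
  Summing over trees according to the children of the root solves \<open>\<Sum>\<^sub>v Y\<^sub>v\<^sup>i T(u, v) = \<delta>\<close> for the matrix \<open>T\<close>
  built from the right-hand side of the theorem with the order of products reversed; the same recursion with the root last
  gives a matrix \<open>P\<close> with \<open>P M = 1\<close>, hence an anti-homomorphism \<open>S\<close> with \<open>S(M) = P\<close>. Applying \<open>S\<close> to the
  equation for \<open>T\<close> yields \<open>S(T) P = 1\<close>, so \<open>S(T) = M\<close>. This shows both that \<open>M P = 1\<close>, so that \<open>S\<close> is
  the antipode, and that \<open>S\<close> maps the tree sums to the generators. Exchanging the roles of \<open>P\<close> and \<open>T\<close>
  gives a left inverse of \<open>S\<close>. Coassociativity is never needed: the antipode is unique because
  the left antipode equation can be solved recursively in the degree.\<close>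

section \<open>Sums over splittings of a word\<close>

lemma splits_Nil [simp]: "splits [] = {([], [])}"
  by (auto simp: splits_def)

lemma splits_Cons: "splits (x # xs) = insert ([], x # xs) ((\<lambda>(a, b). (x # a, b)) ` splits xs)"
  by (auto simp: splits_def Cons_eq_append_conv append_eq_Cons_conv image_iff)

lemma finite_splits [simp]: "finite (splits xs)"
  by (induction xs) (auto simp: splits_Cons)

lemma sum_splits_Cons:
  "(\<Sum>(a, b) \<in> splits (x # xs). G a b) = G [] (x # xs) + (\<Sum>(a, b) \<in> splits xs. G (x # a) b)"
  (is "_ = _ + ?R")
  for G :: "'a list \<Rightarrow> 'a list \<Rightarrow> 'b::comm_monoid_add"
proof -
  have "(\<Sum>(a, b) \<in> (\<lambda>(a, b). (x # a, b)) ` splits xs. G a b) = ?R"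
    by (subst sum.reindex) (auto simp: inj_on_def intro!: sum.cong)
  then show ?thesis
    by (simp add: splits_Cons) (subst sum.insert, auto)
qed

text \<open>Both sides run over the ways to cut \<open>m\<close> into three consecutive pieces; this
  is what makes concatenation products associative.\<close>

lemma sum_splits_assoc:
  "(\<Sum>(x, c) \<in> splits m. \<Sum>(a, b) \<in> splits x. F a b c) =
   (\<Sum>(a, y) \<in> splits m. \<Sum>(b, c) \<in> splits y. F a b c)"
  for F :: "'a list \<Rightarrow> 'a list \<Rightarrow> 'a list \<Rightarrow> 'b::comm_monoid_add"
proof (induction m arbitrary: F)
  case (Cons x xs)
  have "(\<Sum>(y, c) \<in> splits (x # xs). \<Sum>(a, b) \<in> splits y. F a b c) =
    F [] [] (x # xs) + (\<Sum>(y, c) \<in> splits xs. F [] (x # y) c + (\<Sum>(a, b) \<in> splits y. F (x # a) b c))"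
    by (subst sum_splits_Cons) (simp add: sum_splits_Cons)
  also have "\<dots> = F [] [] (x # xs) + (\<Sum>(y, c) \<in> splits xs. F [] (x # y) c) +
      (\<Sum>(a, y) \<in> splits xs. \<Sum>(b, c) \<in> splits y. F (x # a) b c)"
    by (simp add: case_prod_unfold sum.distrib add.assoc
        Cons.IH[of "\<lambda>a. F (x # a)", unfolded case_prod_unfold])
  also have "\<dots> = (\<Sum>(a, y) \<in> splits (x # xs). \<Sum>(b, c) \<in> splits y. F a b c)"
    by (simp add: sum_splits_Cons[of "\<lambda>a y. \<Sum>(b, c) \<in> splits y. F a b c"] sum_splits_Cons add.assoc)
  finally show ?case .
qed simp

text \<open>The pair \<open>(p, q)\<close> is a splitting of \<open>u\<close> exactly when
  \<open>u = p @ q\<close>, so at most one term survives.\<close>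

lemma sum_splits_delta:
  fixes r :: "'b::comm_monoid_add"
  shows "(\<Sum>(a, b) \<in> splits u. if a = p \<and> b = q then r else 0) = (if u = p @ q then r else 0)"
proof -
  have "(\<Sum>(a, b) \<in> splits u. if a = p \<and> b = q then r else 0) =
        (\<Sum>ab \<in> splits u. if (p, q) = ab then r else 0)"
    by (rule sum.cong) (auto split: if_splits)
  also have "\<dots> = (if u = p @ q then r else 0)"
    by (simp only: sum.delta' finite_splits) (auto simp: splits_def)
  finally show ?thesis .
qed

text \<open>Truncates the index set of the word matrices so that their products are finite sums. For
  rows of length at most \<open>n\<close> nothing is lost, by the triangularity
  \<open>wmat_eq_0\<close>.\<close>

definition words_le :: "nat \<Rightarrow> nat \<Rightarrow> nat list set" where
  "words_le N n = {v. set v \<subseteq> {1..N} \<and> length v \<le> n}"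

lemma finite_words_le [simp]: "finite (words_le N n)"
  unfolding words_le_def using finite_lists_length_le[of "{1..N}" n] by (simp add: conj_commute)

lemma words_le_splits: "u \<in> words_le N n \<Longrightarrow> (a, b) \<in> splits u \<Longrightarrow> a \<in> words_le N n \<and> b \<in> words_le N n"
  by (auto simp: words_le_def splits_def)

text \<open>The pairs missing on the left are those whose concatenation is longer than
  \<open>n\<close>, where \<open>G\<close> vanishes.\<close>

lemma sum_words_splits:
  fixes G :: "nat list \<Rightarrow> nat list \<Rightarrow> 'b::comm_monoid_add"
  assumes "\<And>a b. n < length (a @ b) \<Longrightarrow> G a b = 0"
  shows "(\<Sum>v \<in> words_le N n. \<Sum>(a, b) \<in> splits v. G a b) =
         (\<Sum>a \<in> words_le N n. \<Sum>b \<in> words_le N n. G a b)"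
proof -
  have "(\<Sum>v \<in> words_le N n. \<Sum>(a, b) \<in> splits v. G a b) =
        (\<Sum>(v, a, b) \<in> Sigma (words_le N n) splits. G a b)"
    by (subst sum.Sigma) (auto simp: case_prod_unfold)
  also have "\<dots> = (\<Sum>(a, b) \<in> {(a, b). a @ b \<in> words_le N n}. G a b)"
    by (rule sum.reindex_bij_witness[of _ "\<lambda>(a, b). (a @ b, a, b)" "\<lambda>(v, a, b). (a, b)"])
       (auto simp: splits_def)
  also have "\<dots> = (\<Sum>(a, b) \<in> words_le N n \<times> words_le N n. G a b)"
  proof (rule sum.mono_neutral_left)
    show "\<forall>i \<in> words_le N n \<times> words_le N n - {(a, b). a @ b \<in> words_le N n}. (case i of (a, b) \<Rightarrow> G a b) = 0"
      by (auto simp: words_le_def not_le intro!: assms)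
  qed (simp, auto simp: words_le_def)
  also have "\<dots> = (\<Sum>a \<in> words_le N n. \<Sum>b \<in> words_le N n. G a b)"
    by (simp add: sum.cartesian_product)
  finally show ?thesis .
qed

section \<open>Matrices indexed by words\<close>

text \<open>The product is a parameter and not a type class operation, so that one type can carry
  both the concatenation product and its opposite.\<close>

locale ring_ops =
  fixes mul :: "'r::ab_group_add \<Rightarrow> 'r \<Rightarrow> 'r" (infixl "\<odot>" 70) and e :: 'r
  assumes assoc: "(a \<odot> b) \<odot> c = a \<odot> (b \<odot> c)"
    and left_unit [simp]: "e \<odot> a = a"
    and right_unit [simp]: "a \<odot> e = a"
    and distrib_right: "(a + b) \<odot> c = a \<odot> c + b \<odot> c"
    and distrib_left: "a \<odot> (b + c) = a \<odot> b + a \<odot> c"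
begin

lemma mul_zero_left [simp]: "0 \<odot> a = 0"
  using distrib_right[of 0 0 a] by simp

lemma mul_zero_right [simp]: "a \<odot> 0 = 0"
  using distrib_left[of a 0 0] by simp

lemma mul_sum_left: "sum f A \<odot> a = (\<Sum>x \<in> A. f x \<odot> a)"
  by (induction A rule: infinite_finite_induct) (auto simp: distrib_right)

lemma mul_sum_right: "a \<odot> sum f A = (\<Sum>x \<in> A. a \<odot> f x)"
  by (induction A rule: infinite_finite_induct) (auto simp: distrib_left)

lemma opposite: "ring_ops (\<lambda>a b. b \<odot> a) e"
  by unfold_locales (auto simp: assoc distrib_left distrib_right)

end

text \<open>With \<open>x j w\<close> read as the generator indexed by \<open>j\<close> and \<open>w\<close>, the entry at \<open>(u, v)\<close> is the sum over all
  interval partitions of \<open>u\<close> into \<open>|v|\<close> blocks of the product of the generators attached to the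
  letters of \<open>v\<close> and the corresponding blocks.\<close>

fun wmat :: "('r::ab_group_add \<Rightarrow> 'r \<Rightarrow> 'r) \<Rightarrow> 'r \<Rightarrow> (nat \<Rightarrow> nat list \<Rightarrow> 'r) \<Rightarrow>
    nat list \<Rightarrow> nat list \<Rightarrow> 'r" where
  "wmat mul e x u [] = (if u = [] then e else 0)"
| "wmat mul e x u (j # v) = (\<Sum>(a, b) \<in> splits u. mul (x j a) (wmat mul e x b v))"

context ring_ops
begin

text \<open>The blocks attached to \<open>v\<close> fill a prefix of \<open>u\<close>, those
  attached to \<open>w\<close> the remaining suffix.\<close>

lemma wmat_append:
  "wmat (\<odot>) e x u (v @ w) = (\<Sum>(a, b) \<in> splits u. wmat (\<odot>) e x a v \<odot> wmat (\<odot>) e x b w)"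
proof (induction v arbitrary: u)
  case Nil
  have "(\<Sum>(a, b) \<in> splits u. wmat (\<odot>) e x a [] \<odot> wmat (\<odot>) e x b w) =
        (\<Sum>(a, b) \<in> splits u. if a = [] \<and> b = u then wmat (\<odot>) e x u w else 0)"
    by (rule sum.cong) (auto simp: splits_def)
  then show ?case by (simp only: sum_splits_delta) simp
next
  case (Cons j v)
  show ?case
    by (simp add: Cons.IH mul_sum_left mul_sum_right case_prod_unfold assoc)
       (rule sum_splits_assoc[unfolded case_prod_unfold, symmetric])
qed

text \<open>With fewer letters in \<open>u\<close> than in \<open>v\<close> some block has to be
  empty, and its factor is zero.\<close>

lemma wmat_eq_0:
  assumes "\<And>j. x j [] = 0" and "length u < length v"
  shows "wmat (\<odot>) e x u v = 0"
  using assms(2)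
proof (induction v arbitrary: u)
  case (Cons j v)
  have "x j a \<odot> wmat (\<odot>) e x b v = 0" if "(a, b) \<in> splits u" for a b
  proof (cases "a = []")
    case False
    then have "length b < length v"
      using that Cons.prems by (cases a) (auto simp: splits_def)
    then show ?thesis by (simp add: Cons.IH)
  qed (simp add: assms)
  then show ?case by (auto intro!: sum.neutral)
qed simp

lemma wmat_single: "wmat (\<odot>) e x u [j] = x j u"
proof -
  have "wmat (\<odot>) e x u [j] = (\<Sum>(a, b) \<in> splits u. if a = u \<and> b = [] then x j u else 0)"
    by (auto intro!: sum.cong simp: splits_def)
  then show ?thesis by (simp only: sum_splits_delta) simp
qed

text \<open>Passing to the opposite order in the second factor lets the product telescope from the
  inside.\<close>

lemma wmat_mult_opposite:
  assumes x0: "\<And>j. x j [] = 0"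
    and unit: "\<And>u i. u \<in> words_le N n \<Longrightarrow> i \<in> {1..N} \<Longrightarrow>
      (\<Sum>v \<in> words_le N n. wmat (\<odot>) e x u v \<odot> y i v) = (if u = [i] then e else 0)"
    and "u \<in> words_le N n" and "set w \<subseteq> {1..N}"
  shows "(\<Sum>v \<in> words_le N n. wmat (\<odot>) e x u v \<odot> wmat (\<lambda>a b. b \<odot> a) e y v w) =
    (if u = w then e else 0)"
  using assms(3,4)
proof (induction w arbitrary: u)
  case Nil
  have "(\<Sum>v \<in> words_le N n. wmat (\<odot>) e x u v \<odot> wmat (\<lambda>a b. b \<odot> a) e y v []) =
        (\<Sum>v \<in> words_le N n. if v = [] then wmat (\<odot>) e x u [] else 0)"
    by (rule sum.cong) auto
  then show ?case by (simp only: sum.delta finite_words_le) (simp add: words_le_def)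
next
  case (Cons j w)
  let ?W = "words_le N n" and ?X = "wmat (\<odot>) e x" and ?Y = "wmat (\<lambda>a b. b \<odot> a) e y"
  have u: "u \<in> ?W" by fact
  have "(\<Sum>v \<in> ?W. ?X u v \<odot> ?Y v (j # w)) =
        (\<Sum>v \<in> ?W. \<Sum>(v1, v2) \<in> splits v. ?X u (v1 @ v2) \<odot> (?Y v2 w \<odot> y j v1))"
    by (auto simp: mul_sum_right splits_def intro!: sum.cong)
  \<comment> \<open>If \<open>v1 @ v2\<close> is longer than \<open>n\<close>, it is longer than
    \<open>u\<close> and its entry vanishes; hence the two parts may vary independently.\<close>
  also have "\<dots> = (\<Sum>v1 \<in> ?W. \<Sum>v2 \<in> ?W. ?X u (v1 @ v2) \<odot> (?Y v2 w \<odot> y j v1))"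
    using u by (intro sum_words_splits) (subst wmat_eq_0[of x, OF x0], auto simp: words_le_def)
  also have "\<dots> = (\<Sum>v1 \<in> ?W. \<Sum>v2 \<in> ?W. \<Sum>(a, b) \<in> splits u.
      ?X a v1 \<odot> (?X b v2 \<odot> ?Y v2 w) \<odot> y j v1)"
    by (simp add: wmat_append mul_sum_left assoc case_prod_unfold)
  also have "\<dots> = (\<Sum>v1 \<in> ?W. \<Sum>(a, b) \<in> splits u. \<Sum>v2 \<in> ?W.
      ?X a v1 \<odot> (?X b v2 \<odot> ?Y v2 w) \<odot> y j v1)"
    unfolding case_prod_unfold by (intro sum.cong refl sum.swap)
  also have "\<dots> = (\<Sum>(a, b) \<in> splits u. \<Sum>v1 \<in> ?W. \<Sum>v2 \<in> ?W.
      ?X a v1 \<odot> (?X b v2 \<odot> ?Y v2 w) \<odot> y j v1)"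
    unfolding case_prod_unfold by (rule sum.swap)
  also have "\<dots> = (\<Sum>(a, b) \<in> splits u. if a = [j] \<and> b = w then e else 0)"
  proof (intro sum.cong refl, clarify)
    fix a b assume "(a, b) \<in> splits u"
    then have ab: "a \<in> ?W" "b \<in> ?W" using words_le_splits[OF u] by auto
    have "(\<Sum>v1 \<in> ?W. \<Sum>v2 \<in> ?W. ?X a v1 \<odot> (?X b v2 \<odot> ?Y v2 w) \<odot> y j v1) =
          (\<Sum>v1 \<in> ?W. ?X a v1 \<odot> (\<Sum>v2 \<in> ?W. ?X b v2 \<odot> ?Y v2 w) \<odot> y j v1)"
      by (simp add: mul_sum_left mul_sum_right)
    \<comment> \<open>The induction hypothesis collapses the inner sum; what remains is the sum in
      \<open>unit\<close>.\<close>
    also have "\<dots> = (\<Sum>v1 \<in> ?W. if b = w then ?X a v1 \<odot> y j v1 else 0)"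
      using ab Cons.prems by (intro sum.cong refl) (subst Cons.IH, auto)
    also have "\<dots> = (if a = [j] \<and> b = w then e else 0)"
      using unit[of a j] ab Cons.prems by (cases "b = w") auto
    finally show "(\<Sum>v1 \<in> ?W. \<Sum>v2 \<in> ?W. ?X a v1 \<odot> (?X b v2 \<odot> ?Y v2 w) \<odot> y j v1) =
      (if a = [j] \<and> b = w then e else 0)" .
  qed
  also have "\<dots> = (if u = j # w then e else 0)" by (simp only: sum_splits_delta) simp
  finally show ?case .
qed

text \<open>With the reversed order in the first factor, the sum over \<open>v1\<close>, which
  belongs to the first letter, becomes the inner one: \<open>unit\<close> evaluates it first, and
  the induction hypothesis handles the rest.\<close>

lemma wmat_opposite_mult:
  assumes x0: "\<And>j. x j [] = 0"
    and unit: "\<And>u i. u \<in> words_le N n \<Longrightarrow> i \<in> {1..N} \<Longrightarrow>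
      (\<Sum>v \<in> words_le N n. wmat (\<lambda>a b. b \<odot> a) e x u v \<odot> y i v) = (if u = [i] then e else 0)"
    and "u \<in> words_le N n" and "set w \<subseteq> {1..N}"
  shows "(\<Sum>v \<in> words_le N n. wmat (\<lambda>a b. b \<odot> a) e x u v \<odot> wmat (\<odot>) e y v w) =
    (if u = w then e else 0)"
  using assms(3,4)
proof (induction w arbitrary: u)
  case Nil
  have "(\<Sum>v \<in> words_le N n. wmat (\<lambda>a b. b \<odot> a) e x u v \<odot> wmat (\<odot>) e y v []) =
        (\<Sum>v \<in> words_le N n. if v = [] then wmat (\<lambda>a b. b \<odot> a) e x u [] else 0)"
    by (rule sum.cong) auto
  then show ?case by (simp only: sum.delta finite_words_le) (simp add: words_le_def)
next
  case (Cons j w)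
  let ?W = "words_le N n" and ?X = "wmat (\<lambda>a b. b \<odot> a) e x" and ?Y = "wmat (\<odot>) e y"
  have u: "u \<in> ?W" by fact
  have "(\<Sum>v \<in> ?W. ?X u v \<odot> ?Y v (j # w)) =
        (\<Sum>v \<in> ?W. \<Sum>(v1, v2) \<in> splits v. ?X u (v1 @ v2) \<odot> (y j v1 \<odot> ?Y v2 w))"
    by (auto simp: mul_sum_right splits_def intro!: sum.cong)
  also have "\<dots> = (\<Sum>v1 \<in> ?W. \<Sum>v2 \<in> ?W. ?X u (v1 @ v2) \<odot> (y j v1 \<odot> ?Y v2 w))"
    using u by (intro sum_words_splits)
      (subst ring_ops.wmat_eq_0[OF opposite, of x, OF x0], auto simp: words_le_def)
  also have "\<dots> = (\<Sum>v1 \<in> ?W. \<Sum>v2 \<in> ?W. \<Sum>(a, b) \<in> splits u.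
      ?X b v2 \<odot> (?X a v1 \<odot> y j v1) \<odot> ?Y v2 w)"
    by (simp add: ring_ops.wmat_append[OF opposite] mul_sum_left assoc case_prod_unfold)
  also have "\<dots> = (\<Sum>v1 \<in> ?W. \<Sum>(a, b) \<in> splits u. \<Sum>v2 \<in> ?W.
      ?X b v2 \<odot> (?X a v1 \<odot> y j v1) \<odot> ?Y v2 w)"
    unfolding case_prod_unfold by (intro sum.cong refl sum.swap)
  also have "\<dots> = (\<Sum>(a, b) \<in> splits u. \<Sum>v1 \<in> ?W. \<Sum>v2 \<in> ?W.
      ?X b v2 \<odot> (?X a v1 \<odot> y j v1) \<odot> ?Y v2 w)"
    unfolding case_prod_unfold by (rule sum.swap)
  also have "\<dots> = (\<Sum>(a, b) \<in> splits u. if a = [j] \<and> b = w then e else 0)"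
  proof (intro sum.cong refl, clarify)
    fix a b assume "(a, b) \<in> splits u"
    then have ab: "a \<in> ?W" "b \<in> ?W" using words_le_splits[OF u] by auto
    have "(\<Sum>v1 \<in> ?W. \<Sum>v2 \<in> ?W. ?X b v2 \<odot> (?X a v1 \<odot> y j v1) \<odot> ?Y v2 w) =
          (\<Sum>v2 \<in> ?W. ?X b v2 \<odot> (\<Sum>v1 \<in> ?W. ?X a v1 \<odot> y j v1) \<odot> ?Y v2 w)"
      by (subst sum.swap) (simp add: mul_sum_left mul_sum_right)
    also have "\<dots> = (\<Sum>v2 \<in> ?W. if a = [j] then ?X b v2 \<odot> ?Y v2 w else 0)"
      using ab Cons.prems by (intro sum.cong refl) (subst unit, auto)
    also have "\<dots> = (if a = [j] \<and> b = w then e else 0)"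
      using Cons.IH[of b] ab Cons.prems by (cases "a = [j]") auto
    finally show "(\<Sum>v1 \<in> ?W. \<Sum>v2 \<in> ?W. ?X b v2 \<odot> (?X a v1 \<odot> y j v1) \<odot> ?Y v2 w) =
      (if a = [j] \<and> b = w then e else 0)" .
  qed
  also have "\<dots> = (if u = j # w then e else 0)" by (simp only: sum_splits_delta) simp
  finally show ?case .
qed

section \<open>Comparison of left and right inverse matrices\<close>

text \<open>X = X (P M) = (X P) M = M, where only row \<open>u\<close> of X and column
  \<open>w\<close> of M enter.\<close>

lemma matrix_inverses_equal:
  assumes "finite W" and "u \<in> W" and "w \<in> W"
    and XP: "\<And>v. v \<in> W \<Longrightarrow> (\<Sum>p \<in> W. X u p \<odot> P p v) = (if u = v then e else 0)"
    and PM: "\<And>p. p \<in> W \<Longrightarrow> (\<Sum>v \<in> W. P p v \<odot> M v w) = (if p = w then e else 0)"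
  shows "X u w = M u w"
proof -
  have "X u w = (\<Sum>p \<in> W. X u p \<odot> (\<Sum>v \<in> W. P p v \<odot> M v w))"
    using assms(1,3) by (simp add: PM if_distrib[of "\<lambda>a. _ \<odot> a"] cong: sum.cong if_cong)
  also have "\<dots> = (\<Sum>v \<in> W. (\<Sum>p \<in> W. X u p \<odot> P p v) \<odot> M v w)"
    by (simp add: mul_sum_left mul_sum_right assoc) (rule sum.swap)
  also have "\<dots> = M u w"
    using assms(1,2) by (simp add: XP if_distrib[of "\<lambda>a. a \<odot> _"] cong: sum.cong if_cong)
  finally show ?thesis .
qed

text \<open>The hypotheses concern one-letter columns. The two product lemmas extend them to all
  words, so the reversed-order matrix of \<open>s\<close> has the matrix of \<open>x\<close> as a
  left and that of \<open>y\<close> as a right inverse.\<close>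

lemma wmat_opposite_inverses_equal:
  assumes "\<And>j. x j [] = 0" and "\<And>j. s j [] = 0"
    and xs: "\<And>u i. u \<in> words_le N n \<Longrightarrow> i \<in> {1..N} \<Longrightarrow>
      (\<Sum>v \<in> words_le N n. wmat (\<odot>) e x u v \<odot> s i v) = (if u = [i] then e else 0)"
    and sy: "\<And>u i. u \<in> words_le N n \<Longrightarrow> i \<in> {1..N} \<Longrightarrow>
      (\<Sum>v \<in> words_le N n. wmat (\<lambda>a b. b \<odot> a) e s u v \<odot> y i v) = (if u = [i] then e else 0)"
    and uw: "u \<in> words_le N n" "w \<in> words_le N n"
  shows "wmat (\<odot>) e x u w = wmat (\<odot>) e y u w"
proof (rule matrix_inverses_equal[OF finite_words_le uw])
  fix v assume "v \<in> words_le N n"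
  then show "(\<Sum>p \<in> words_le N n. wmat (\<odot>) e x u p \<odot> wmat (\<lambda>a b. b \<odot> a) e s p v) =
      (if u = v then e else 0)"
    using uw by (intro wmat_mult_opposite assms(1) xs) (auto simp: words_le_def)
next
  fix p assume "p \<in> words_le N n"
  then show "(\<Sum>v \<in> words_le N n. wmat (\<lambda>a b. b \<odot> a) e s p v \<odot> wmat (\<odot>) e y v w) =
      (if p = w then e else 0)"
    using uw by (intro wmat_opposite_mult assms(2) sy) (auto simp: words_le_def)
qed

text \<open>Companion of the previous lemma in the opposite ring: products change sides, and the two
  product lemmas exchange their roles.\<close>

lemma wmat_opposite_inverses_equal':
  assumes "\<And>j. z j [] = 0" and "\<And>j. t j [] = 0"
    and zt: "\<And>u i. u \<in> words_le N n \<Longrightarrow> i \<in> {1..N} \<Longrightarrow>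
      (\<Sum>v \<in> words_le N n. t i v \<odot> wmat (\<odot>) e z u v) = (if u = [i] then e else 0)"
    and ty: "\<And>u i. u \<in> words_le N n \<Longrightarrow> i \<in> {1..N} \<Longrightarrow>
      (\<Sum>v \<in> words_le N n. y i v \<odot> wmat (\<lambda>a b. b \<odot> a) e t u v) = (if u = [i] then e else 0)"
    and uw: "u \<in> words_le N n" "w \<in> words_le N n"
  shows "wmat (\<odot>) e z u w = wmat (\<odot>) e y u w"
proof (rule ring_ops.matrix_inverses_equal[OF opposite finite_words_le uw])
  fix v assume "v \<in> words_le N n"
  then show "(\<Sum>p \<in> words_le N n. wmat (\<lambda>a b. b \<odot> a) e t p v \<odot> wmat (\<odot>) e z u p) =
      (if u = v then e else 0)"
    using uw by (intro ring_ops.wmat_opposite_mult[OF opposite] assms(1) zt) (auto simp: words_le_def)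
next
  fix p assume "p \<in> words_le N n"
  then show "(\<Sum>v \<in> words_le N n. wmat (\<odot>) e y v w \<odot> wmat (\<lambda>a b. b \<odot> a) e t p v) =
      (if p = w then e else 0)"
    using uw by (intro ring_ops.wmat_mult_opposite[OF opposite] assms(2) ty) (auto simp: words_le_def)
qed

lemma wmat_cong:
  assumes "\<And>j a. j \<in> set v \<Longrightarrow> x j a = x' j a"
  shows "wmat (\<odot>) e x u v = wmat (\<odot>) e x' u v"
  using assms by (induction v arbitrary: u) (auto intro!: sum.cong)

end

section \<open>Weighted sums over reduced trees\<close>

lemma leaves_Node: "ts \<noteq> [] \<Longrightarrow> leaves (Node c ts) = concat (map leaves ts)"
  by (cases ts) auto

lemma leaves_nonempty: "leaves T \<noteq> []"
proof (induction T)
  case (Node c ts)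
  then show ?case by (cases ts) auto
qed

lemma length_le_leaves: "length ts \<le> length (concat (map leaves ts))"
proof (induction ts)
  case (Cons t ts)
  then show ?case using leaves_nonempty[of t] by (cases "leaves t") auto
qed simp

text \<open>The candidates for the child list of a vertex: \<open>v\<close> becomes the lower index
  of its generator, \<open>u\<close> its leaf word.\<close>

definition forests :: "nat \<Rightarrow> nat list \<Rightarrow> nat list \<Rightarrow> tree list set" where
  "forests N v u = {ts. map root ts = v \<and> concat (map leaves ts) = u \<and>
     (\<forall>t \<in> set ts. reduced t \<and> colours_ok N t)}"

text \<open>Every sibling owns at least one leaf. This allows induction on the number of leaves for
  reduced trees.\<close>

lemma length_leaves_child:
  assumes "t \<in> set ts" and "2 \<le> length ts"
  shows "length (leaves t) < length (concat (map leaves ts))"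
proof -
  obtain xs ys where ts: "ts = xs @ t # ys" using assms(1) by (meson split_list)
  have "length xs + length ys \<le> length (concat (map leaves xs)) + length (concat (map leaves ys))"
    by (intro add_mono length_le_leaves)
  moreover have "0 < length xs + length ys"
    using assms(2) unfolding ts length_append list.size by linarith
  ultimately have "0 < length (concat (map leaves xs)) + length (concat (map leaves ys))" by linarith
  then show ?thesis by (simp only: ts map_append concat_append length_append list.map concat.simps)
qed

text \<open>The leaf count bounds the number of children, and reducedness makes every child smaller,
  so the trees with at most n + 1 leaves are built from those with at most n.\<close>

lemma finite_reduced_trees: "finite {T. reduced T \<and> colours_ok N T \<and> length (leaves T) \<le> n}"
proof (induction n)
  case 0
  then show ?case using leaves_nonempty by simp
next
  case (Suc n)
  let ?B = "{T. reduced T \<and> colours_ok N T \<and> length (leaves T) \<le> n}"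
  let ?F = "{ts. set ts \<subseteq> ?B \<and> length ts \<le> Suc n}"
  have "{T. reduced T \<and> colours_ok N T \<and> length (leaves T) \<le> Suc n} \<subseteq>
        (\<lambda>(c, ts). Node c ts) ` ({1..N} \<times> ?F)"
  proof
    fix T assume T: "T \<in> {T. reduced T \<and> colours_ok N T \<and> length (leaves T) \<le> Suc n}"
    obtain c ts where Tc: "T = Node c ts" by (cases T)
    have "ts \<in> ?F"
    proof (cases "ts = []")
      case False
      then have len: "length (concat (map leaves ts)) \<le> Suc n" and "2 \<le> length ts"
        using T by (auto simp: Tc leaves_Node)
      then have "length (leaves t) \<le> n" if "t \<in> set ts" for t
        using length_leaves_child[OF that] by simp
      then show ?thesis
        using T len length_le_leaves[of ts] by (auto simp: Tc)
    qed simp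
    then show "T \<in> (\<lambda>(c, ts). Node c ts) ` ({1..N} \<times> ?F)"
      using T by (auto simp: Tc)
  qed
  moreover have "finite ({1..N} \<times> ?F)"
    using Suc.IH by (intro finite_cartesian_product finite_lists_length_le) auto
  ultimately show ?case by (meson finite_imageI finite_subset)
qed

lemma finite_RT [simp]: "finite (RT N i u)"
  by (rule finite_subset[OF _ finite_reduced_trees[of N "length u"]]) (auto simp: RT_def)

lemma finite_forests [simp]: "finite (forests N v u)"
proof (rule finite_subset)
  let ?B = "{T. reduced T \<and> colours_ok N T \<and> length (leaves T) \<le> length u}"
  show "forests N v u \<subseteq> {ts. set ts \<subseteq> ?B \<and> length ts \<le> length v}"
  proof
    fix ts assume ts: "ts \<in> forests N v u"
    have "length (leaves t) \<le> length u" if "t \<in> set ts" for t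
    proof -
      obtain xs ys where "ts = xs @ t # ys" using split_list[OF \<open>t \<in> set ts\<close>] by blast
      with ts show ?thesis by (auto simp: forests_def)
    qed
    with ts show "ts \<in> {ts. set ts \<subseteq> ?B \<and> length ts \<le> length v}"
      by (auto simp: forests_def)
  qed
  show "finite {ts. set ts \<subseteq> ?B \<and> length ts \<le> length v}"
    by (rule finite_lists_length_le[OF finite_reduced_trees])
qed

lemma RT_Nil: "RT N i [] = {}"
  using leaves_nonempty by (auto simp: RT_def)

lemma RT_single:
  assumes "i \<in> {1..N}"
  shows "RT N i [j] = (if i = j then {Node i []} else {})"
proof -
  have "T = Node i [] \<and> i = j" if "T \<in> RT N i [j]" for T
  proof -
    obtain c ts where T: "T = Node c ts" by (cases T)
    have "ts = []"
    proof (rule ccontr)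
      assume "ts \<noteq> []"
      then have "length (concat (map leaves ts)) = 1" and "2 \<le> length ts"
        using that by (auto simp: RT_def T leaves_Node)
      then show False using length_le_leaves[of ts] by simp
    qed
    with that show ?thesis by (simp add: RT_def T)
  qed
  moreover have "Node i [] \<in> RT N i [i]" using assms by (simp add: RT_def)
  ultimately show ?thesis by auto
qed

section \<open>Tree weights and the splitting of trees at the root\<close>

text \<open>\<open>\<phi>\<close> inserts the root generator and \<open>mul\<close> orders the
  subtrees, so one recursion covers root-first and root-last products. The minus signs of the inner
  vertices accumulate to the sign in the theorem.\<close>

fun tree_weight :: "(nat \<Rightarrow> nat list \<Rightarrow> 'r \<Rightarrow> 'r) \<Rightarrow> ('r \<Rightarrow> 'r \<Rightarrow> 'r) \<Rightarrow> 'r::ab_group_add \<Rightarrow> tree \<Rightarrow> 'r" where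
  "tree_weight \<phi> mul e (Node c []) = e"
| "tree_weight \<phi> mul e (Node c (t # ts)) =
    - \<phi> c (map root (t # ts)) (foldr mul (map (tree_weight \<phi> mul e) (t # ts)) e)"

definition tree_sum ::
  "(nat \<Rightarrow> nat list \<Rightarrow> 'r \<Rightarrow> 'r) \<Rightarrow> ('r \<Rightarrow> 'r \<Rightarrow> 'r) \<Rightarrow> 'r::ab_group_add \<Rightarrow> nat \<Rightarrow> nat \<Rightarrow> nat list \<Rightarrow> 'r" where
  "tree_sum \<phi> mul e N i u = (\<Sum>T \<in> RT N i u. tree_weight \<phi> mul e T)"

lemma tree_sum_Nil: "tree_sum \<phi> mul e N i [] = 0"
  by (simp add: tree_sum_def RT_Nil)

lemma tree_sum_single: "i \<in> {1..N} \<Longrightarrow> tree_sum \<phi> mul e N i [j] = (if i = j then e else 0)"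
  by (simp add: tree_sum_def RT_single del: atLeastAtMost_iff)

lemma tree_weight_Node:
  "ts \<noteq> [] \<Longrightarrow> tree_weight \<phi> mul e (Node c ts) =
    - \<phi> c (map root ts) (foldr mul (map (tree_weight \<phi> mul e) ts) e)"
  by (cases ts) auto

context ring_ops
begin

text \<open>By distributivity, a product of tree sums chooses one tree for each block of the leaf
  word; such a choice is a forest.\<close>

lemma wmat_tree_sum:
  "wmat (\<odot>) e (tree_sum \<phi> (\<odot>) e N) u v =
    (\<Sum>ts \<in> forests N v u. foldr (\<odot>) (map (tree_weight \<phi> (\<odot>) e) ts) e)"
proof (induction v arbitrary: u)
  case Nil
  have "forests N [] u = (if u = [] then {[]} else {})" by (auto simp: forests_def)
  then show ?case by simp
next
  case (Cons j v)
  let ?w = "tree_weight \<phi> (\<odot>) e"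
  let ?f = "\<lambda>ts. foldr (\<odot>) (map ?w ts) e"
  have "wmat (\<odot>) e (tree_sum \<phi> (\<odot>) e N) u (j # v) =
    (\<Sum>(a, b) \<in> splits u. \<Sum>T \<in> RT N j a. \<Sum>ts \<in> forests N v b. ?f (T # ts))"
    by (simp add: Cons.IH mul_sum_right)
       (simp add: tree_sum_def mul_sum_left case_prod_unfold sum.swap[of _ "RT N j _"])
  also have "\<dots> = (\<Sum>ab \<in> splits u. \<Sum>(T, ts) \<in> RT N j (fst ab) \<times> forests N v (snd ab). ?f (T # ts))"
    by (simp add: sum.cartesian_product case_prod_unfold)
  also have "\<dots> = (\<Sum>(ab, T, ts) \<in> Sigma (splits u) (\<lambda>ab. RT N j (fst ab) \<times> forests N v (snd ab)). ?f (T # ts))"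
    by (subst sum.Sigma) (auto simp: case_prod_unfold)
  also have "\<dots> = (\<Sum>ts \<in> forests N (j # v) u. ?f ts)"
    by (rule sum.reindex_bij_witness[of _
          "\<lambda>ts. ((leaves (hd ts), concat (map leaves (tl ts))), hd ts, tl ts)" "\<lambda>(ab, T, ts). T # ts"])
       (auto simp: splits_def forests_def RT_def)
  finally show ?case .
qed

text \<open>Splitting a tree at its root: in the sum over \<open>v\<close>, the word \<open>[i]\<close> contributes the sum over all trees,
  the longer words cancel every tree that is not a single leaf.\<close>

lemma tree_sum_inverse:
  assumes add: "\<And>i v a b. \<phi> i v (a + b) = \<phi> i v a + \<phi> i v b"
    and \<phi>_Nil: "\<And>i a. \<phi> i [] a = 0"
    and \<phi>_single: "\<And>i j a. \<phi> i [j] a = (if i = j then a else 0)"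
    and u: "u \<in> words_le N n" and i: "i \<in> {1..N}" and "1 \<le> n"
  shows "(\<Sum>v \<in> words_le N n. \<phi> i v (wmat (\<odot>) e (tree_sum \<phi> (\<odot>) e N) u v)) =
    (if u = [i] then e else 0)"
proof -
  let ?w = "tree_weight \<phi> (\<odot>) e" and ?t = "tree_sum \<phi> (\<odot>) e N" and ?W = "words_le N n"
  let ?F = "\<lambda>v. {ts \<in> forests N v u. 2 \<le> length ts}"
  let ?R = "{T \<in> RT N i u. T \<noteq> Node i []}"
  have \<phi>0: "\<phi> i v 0 = 0" for i v using add[of i v 0 0] by simp
  have \<phi>_sum: "\<phi> i v (sum f A) = (\<Sum>x \<in> A. \<phi> i v (f x))" for i v A and f :: "tree list \<Rightarrow> 'r"
    by (induction A rule: infinite_finite_induct) (auto simp: add \<phi>0)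
  \<comment> \<open>A word of length at least 2 is a child word of a root coloured \<open>i\<close>
    and yields minus the weights of these trees; \<open>[i]\<close> yields the whole tree sum; all
    other words yield 0.\<close>
  have "\<phi> i v (wmat (\<odot>) e ?t u v) = (if v = [i] then ?t i u else 0) - (\<Sum>ts \<in> ?F v. ?w (Node i ts))" for v
  proof (cases "2 \<le> length v")
    case True
    then have "?F v = forests N v u" and "v \<noteq> [i]" by (auto simp: forests_def)
    moreover have "\<phi> i v (foldr (\<odot>) (map ?w ts) e) = - ?w (Node i ts)" if "ts \<in> forests N v u" for ts
      using that True by (subst tree_weight_Node) (auto simp: forests_def)
    ultimately show ?thesis by (simp add: wmat_tree_sum \<phi>_sum sum_negf)
  next
    case False
    then have F: "?F v = {}" by (auto simp: forests_def)
    have F: "(\<Sum>ts \<in> ?F v. ?w (Node i ts)) = 0" unfolding F by simp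
    from False consider "v = []" | j where "v = [j]"
      by (cases v rule: remdups_adj.cases) auto
    then show ?thesis
    proof cases
      case 1
      show ?thesis unfolding F unfolding 1 by (simp add: \<phi>_Nil)
    next
      case (2 j)
      show ?thesis unfolding F unfolding 2 by (simp add: \<phi>_single wmat_single del: wmat.simps)
    qed
  qed
  then have "(\<Sum>v \<in> ?W. \<phi> i v (wmat (\<odot>) e ?t u v)) =
      (\<Sum>v \<in> ?W. if v = [i] then ?t i u else 0) - (\<Sum>v \<in> ?W. \<Sum>ts \<in> ?F v. ?w (Node i ts))"
    by (simp add: sum_subtractf)
  \<comment> \<open>\<open>1 \<le> n\<close> ensures that \<open>[i]\<close> is among the words
    summed over.\<close>
  also have "(\<Sum>v \<in> ?W. if v = [i] then ?t i u else 0) = ?t i u"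
    using i \<open>1 \<le> n\<close> by (simp only: sum.delta finite_words_le) (simp add: words_le_def)
  also have "(\<Sum>v \<in> ?W. \<Sum>ts \<in> ?F v. ?w (Node i ts)) = (\<Sum>(v, ts) \<in> Sigma ?W ?F. ?w (Node i ts))"
    by (subst sum.Sigma) auto
  \<comment> \<open>A tree other than the single vertex is given by its list of children; the child
    word stays within the bound since every child owns a leaf.\<close>
  also have "\<dots> = (\<Sum>T \<in> ?R. ?w T)"
  proof (rule sum.reindex_bij_witness[of _ "\<lambda>T. case T of Node c ts \<Rightarrow> (map root ts, ts)" "\<lambda>(v, ts). Node i ts"])
    fix T assume T: "T \<in> ?R"
    obtain c ts where [simp]: "T = Node c ts" by (cases T)
    have ts: "ts \<noteq> []" and c: "c = i" using T by (auto simp: RT_def)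
    then have "2 \<le> length ts" and "concat (map leaves ts) = u" and "\<forall>t \<in> set ts. reduced t \<and> colours_ok N t"
      using T by (auto simp: RT_def leaves_Node)
    moreover have "root t \<in> {1..N}" if "t \<in> set ts" for t
      using calculation(3) that by (cases t) auto
    moreover have "length ts \<le> n"
      using u calculation(2) length_le_leaves[of ts] by (auto simp: words_le_def)
    ultimately show "(case T of Node c ts \<Rightarrow> (map root ts, ts)) \<in> Sigma ?W ?F"
      by (auto simp: words_le_def forests_def)
    show "(case case T of Node c ts \<Rightarrow> (map root ts, ts) of (v, ts) \<Rightarrow> Node i ts) = T"
      by (simp add: c)
  qed (use i in \<open>auto simp: RT_def forests_def intro!: leaves_Node\<close>)
  \<comment> \<open>The single vertex has weight \<open>e\<close>, occurs only for
    \<open>u = [i]\<close>, and is the one term left uncancelled.\<close>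
  also have "?t i u = (\<Sum>T \<in> ?R. ?w T) + (if u = [i] then e else 0)"
  proof -
    have "RT N i u = ?R \<union> (if u = [i] then {Node i []} else {})"
    proof -
      have "Node i [] \<in> RT N i u \<longleftrightarrow> u = [i]" using i by (auto simp: RT_def)
      then show ?thesis by auto
    qed
    then have "?t i u = (\<Sum>T \<in> ?R \<union> (if u = [i] then {Node i []} else {}). ?w T)"
      by (simp add: tree_sum_def)
    also have "\<dots> = (\<Sum>T \<in> ?R. ?w T) + (if u = [i] then e else 0)"
      by (subst sum.union_disjoint) auto
    finally show ?thesis .
  qed
  finally show ?thesis by simp
qed

end

section \<open>Linear extension of maps on a basis\<close>

text \<open>Basis vectors over any index type, so that one calculus serves monomials and pairs of
  monomials, that is, the algebra and its tensor square.\<close>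

definition delta :: "'a \<Rightarrow> 'a \<Rightarrow> complex" where
  "delta x = (\<lambda>y. if y = x then 1 else 0)"

definition fs :: "'a set \<Rightarrow> ('a \<Rightarrow> complex) set" where
  "fs D = {f. finite (supp f) \<and> supp f \<subseteq> D}"

text \<open>Summing over the support matches the form of \<open>Delta\<close> and
  \<open>tmap\<close>. Additivity is shown for finite supports, whence the side conditions with
  \<open>fs\<close> below.\<close>

definition lin :: "('a \<Rightarrow> 'b \<Rightarrow> complex) \<Rightarrow> ('a \<Rightarrow> complex) \<Rightarrow> 'b \<Rightarrow> complex" where
  "lin F f = (\<Sum>x \<in> supp f. smult (f x) (F x))"

lemma sum_fun_apply: "(\<Sum>x \<in> A. F x) y = (\<Sum>x \<in> A. F x y)"
  for F :: "'a \<Rightarrow> 'b \<Rightarrow> complex"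
  by (induction A rule: infinite_finite_induct) auto

lemma smult_simps [simp]:
  "smult 0 f = 0" "smult 1 f = f" "smult c 0 = 0" "smult c (smult d f) = smult (c * d) f"
  by (auto simp: smult_def)

lemma smult_add: "smult c (f + g) = smult c f + smult c g"
  and smult_add_left: "smult (c + d) f = smult c f + smult d f"
  by (auto simp: smult_def algebra_simps)

lemma smult_sum: "smult c (\<Sum>x \<in> A. F x) = (\<Sum>x \<in> A. smult c (F x))"
  by (induction A rule: infinite_finite_induct) (auto simp: smult_add simp del: plus_fun_apply zero_fun_apply)

lemma fs_zero [simp]: "0 \<in> fs D"
  by (auto simp: fs_def supp_def)

lemma fs_delta: "x \<in> D \<Longrightarrow> delta x \<in> fs D"
  by (auto simp: fs_def supp_def delta_def)

lemma fs_add: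
  assumes "f \<in> fs D" and "g \<in> fs D"
  shows "f + g \<in> fs D"
proof -
  have "supp (f + g) \<subseteq> supp f \<union> supp g" by (auto simp: supp_def)
  with assms show ?thesis unfolding fs_def by (auto intro: finite_subset)
qed

lemma fs_smult:
  assumes "f \<in> fs D"
  shows "smult c f \<in> fs D"
proof -
  have "supp (smult c f) \<subseteq> supp f" by (auto simp: supp_def smult_def)
  with assms show ?thesis unfolding fs_def by (auto intro: finite_subset)
qed

lemma fs_uminus: "f \<in> fs D \<Longrightarrow> - f \<in> fs D"
  by (simp add: fs_def supp_def)

lemma fs_sum: "(\<And>x. x \<in> A \<Longrightarrow> F x \<in> fs D) \<Longrightarrow> (\<Sum>x \<in> A. F x) \<in> fs D"
  by (induction A rule: infinite_finite_induct) (auto intro: fs_add)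

lemma fs_lin: "(\<And>x. x \<in> supp f \<Longrightarrow> F x \<in> fs D) \<Longrightarrow> lin F f \<in> fs D"
  unfolding lin_def by (intro fs_sum fs_smult)

lemma fs_mono: "D \<subseteq> E \<Longrightarrow> f \<in> fs D \<Longrightarrow> f \<in> fs E"
  by (auto simp: fs_def)

lemma fs_UNIV: "f \<in> fs D \<Longrightarrow> f \<in> fs UNIV"
  by (auto simp: fs_def)

lemma fs_tens:
  assumes "f \<in> fs A" and "g \<in> fs B"
  shows "tens f g \<in> fs (A \<times> B)"
proof -
  have "supp (tens f g) = supp f \<times> supp g" by (auto simp: supp_def tens_def)
  with assms show ?thesis by (auto simp: fs_def)
qed

lemma lin_superset:
  assumes "finite A" and "supp f \<subseteq> A"
  shows "lin F f = (\<Sum>x \<in> A. smult (f x) (F x))"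
  unfolding lin_def using assms by (intro sum.mono_neutral_left) (auto simp: supp_def)

lemma lin_cong: "(\<And>x. x \<in> supp f \<Longrightarrow> F x = G x) \<Longrightarrow> lin F f = lin G f"
  by (simp add: lin_def)

lemma lin_zero [simp]: "lin F 0 = 0"
  by (simp add: lin_def supp_def)

lemma lin_zero_fun: "lin (\<lambda>x. 0) f = 0"
  by (simp add: lin_def)

lemma lin_delta [simp]: "lin F (delta x) = F x"
proof -
  have "supp (delta x) = {x}" by (auto simp: supp_def delta_def)
  then show ?thesis by (simp add: lin_def delta_def)
qed

lemma lin_delta_id:
  assumes "f \<in> fs D"
  shows "lin delta f = f"
proof
  fix y
  have "lin delta f y = (\<Sum>x \<in> supp f. if x = y then f x else 0)"
    by (auto simp: lin_def sum_fun_apply smult_def delta_def intro!: sum.cong)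
  also have "\<dots> = f y" using assms by (simp add: fs_def) (simp add: supp_def)
  finally show "lin delta f y = f y" .
qed

lemma lin_add:
  assumes "f \<in> fs D" and "g \<in> fs E"
  shows "lin F (f + g) = lin F f + lin F g"
proof -
  let ?A = "supp f \<union> supp g"
  have "finite ?A" using assms by (simp add: fs_def)
  moreover have "supp (f + g) \<subseteq> ?A" by (auto simp: supp_def)
  ultimately show ?thesis
    by (simp add: lin_superset[of ?A] smult_add_left sum.distrib)
qed

lemma lin_smult: "lin F (smult c f) = smult c (lin F f)"
proof (cases "c = 0")
  case False
  then have "supp (smult c f) = supp f" by (auto simp: supp_def smult_def)
  then show ?thesis by (simp add: lin_def smult_sum) (simp add: smult_def)
qed simp

lemma lin_sum:
  assumes "\<And>x. x \<in> A \<Longrightarrow> f x \<in> fs D"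
  shows "lin F (\<Sum>x \<in> A. f x) = (\<Sum>x \<in> A. lin F (f x))"
  using assms
proof (induction A rule: infinite_finite_induct)
  case (insert x A)
  then have "f x \<in> fs D" and "(\<Sum>x \<in> A. f x) \<in> fs D" by (auto intro: fs_sum)
  then have "lin F (f x + (\<Sum>x \<in> A. f x)) = lin F (f x) + lin F (\<Sum>x \<in> A. f x)" by (rule lin_add)
  with insert show ?case by (simp del: plus_fun_apply)
qed (simp_all del: zero_fun_apply)

lemma lin_lin:
  assumes "\<And>x. x \<in> supp f \<Longrightarrow> G x \<in> fs D"
  shows "lin F (lin G f) = lin (\<lambda>x. lin F (G x)) f"
  unfolding lin_def[of G] lin_def[of "\<lambda>x. lin F (G x)"]
  by (subst lin_sum[where D = D]) (auto simp: assms fs_smult lin_smult)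

lemma lin_swap: "lin (\<lambda>p. lin (\<lambda>q. X p q) t) s = lin (\<lambda>q. lin (\<lambda>p. X p q) s) t"
  unfolding lin_def by (simp add: smult_sum mult.commute) (rule sum.swap)

section \<open>The free algebra and its tensor square\<close>

lemma monom_delta: "monom m = delta m"
  by (simp add: monom_def delta_def)

lemma one_delta: "one = delta []"
  by (simp add: one_def monom_delta)

text \<open>From here on the locale facts speak of the concatenation product; the reversed product
  is reached through \<open>opposite\<close>.\<close>

interpretation ring_ops amult one
proof
  fix a b c :: alg
  show "amult (amult a b) c = amult a (amult b c)"
  proof
    fix m
    have "amult (amult a b) c m = (\<Sum>(x, y) \<in> splits m. \<Sum>(p, q) \<in> splits x. a p * b q * c y)"
      by (simp add: amult_def sum_distrib_right case_prod_unfold)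
    also have "\<dots> = (\<Sum>(p, x) \<in> splits m. \<Sum>(q, y) \<in> splits x. a p * b q * c y)"
      by (rule sum_splits_assoc)
    also have "\<dots> = amult a (amult b c) m"
      by (simp add: amult_def sum_distrib_left case_prod_unfold mult.assoc)
    finally show "amult (amult a b) c m = amult a (amult b c) m" .
  qed
  show "amult one a = a"
  proof
    fix m
    have "amult one a m = (\<Sum>(p, q) \<in> splits m. if p = [] \<and> q = m then a m else 0)"
      by (auto simp: amult_def one_def monom_def splits_def intro!: sum.cong)
    then show "amult one a m = a m" by (simp only: sum_splits_delta) simp
  qed
  show "amult a one = a"
  proof
    fix m
    have "amult a one m = (\<Sum>(p, q) \<in> splits m. if p = m \<and> q = [] then a m else 0)"
      by (auto simp: amult_def one_def monom_def splits_def intro!: sum.cong)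
    then show "amult a one m = a m" by (simp only: sum_splits_delta) simp
  qed
  show "amult (a + b) c = amult a c + amult b c"
    by (auto simp: amult_def case_prod_unfold sum.distrib algebra_simps)
  show "amult a (b + c) = amult a b + amult a c"
    by (auto simp: amult_def case_prod_unfold sum.distrib algebra_simps)
qed

lemma amult_smult_left: "amult (smult c f) g = smult c (amult f g)"
  and amult_smult_right: "amult f (smult c g) = smult c (amult f g)"
  by (auto simp: amult_def smult_def case_prod_unfold sum_distrib_left mult.assoc mult.left_commute)

lemma amult_delta: "amult (delta a) (delta b) = delta (a @ b)"
proof
  fix m
  have "amult (delta a) (delta b) m = (\<Sum>(p, q) \<in> splits m. if p = a \<and> q = b then 1 else 0)"
    by (auto simp: amult_def delta_def intro!: sum.cong)
  also have "\<dots> = delta (a @ b) m" by (simp only: sum_splits_delta delta_def)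
  finally show "amult (delta a) (delta b) m = delta (a @ b) m" .
qed

lemma lin_amult_left: "lin (\<lambda>x. amult (F x) c) f = amult (lin F f) c"
  by (simp add: lin_def mul_sum_left amult_smult_left)

lemma lin_amult_right: "lin (\<lambda>x. amult c (F x)) f = amult c (lin F f)"
  by (simp add: lin_def mul_sum_right amult_smult_right)

lemma amult_expand:
  assumes "f \<in> fs D" and "g \<in> fs E"
  shows "amult f g = lin (\<lambda>a. lin (\<lambda>b. delta (a @ b)) g) f"
proof -
  have "amult f g = amult (lin delta f) (lin delta g)" using assms by (simp add: lin_delta_id)
  also have "\<dots> = lin (\<lambda>a. amult (delta a) (lin delta g)) f" by (rule lin_amult_left[symmetric])
  finally show ?thesis by (simp only: lin_amult_right[symmetric] amult_delta)
qed

lemma fs_amult: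
  assumes "f \<in> fs D" and "g \<in> fs E" and "\<And>a b. a \<in> D \<Longrightarrow> b \<in> E \<Longrightarrow> a @ b \<in> C"
  shows "amult f g \<in> fs C"
  unfolding amult_expand[OF assms(1,2)]
  using assms by (intro fs_lin fs_delta) (auto simp: fs_def)

lemma fs_UNIV_amult: "f \<in> fs UNIV \<Longrightarrow> g \<in> fs UNIV \<Longrightarrow> amult f g \<in> fs UNIV"
  by (rule fs_amult) auto

lemma fs_UNIV_one: "one \<in> fs UNIV"
  by (simp add: one_delta fs_delta)

lemma lin_amult:
  assumes "f \<in> fs D" and "g \<in> fs E"
  shows "lin F (amult f g) = lin (\<lambda>a. lin (\<lambda>b. F (a @ b)) g) f"
  unfolding amult_expand[OF assms]
  by (subst lin_lin[where D = UNIV], simp add: fs_lin fs_delta)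
     (subst lin_lin[where D = UNIV], auto simp: fs_delta)

section \<open>Products and linear maps on the tensor square\<close>

lemma tmult_add_left: "tmult (s + s') t = tmult s t + tmult s' t"
  and tmult_add_right: "tmult s (t + t') = tmult s t + tmult s t'"
  by (auto simp: tmult_def case_prod_unfold sum.distrib algebra_simps)

lemma tmult_smult_left: "tmult (smult c s) t = smult c (tmult s t)"
  and tmult_smult_right: "tmult s (smult c t) = smult c (tmult s t)"
  by (auto simp: tmult_def smult_def case_prod_unfold sum_distrib_left mult.assoc mult.left_commute)

lemma tmult_sum_left: "tmult (\<Sum>x \<in> A. F x) t = (\<Sum>x \<in> A. tmult (F x) t)"
  and tmult_sum_right: "tmult t (\<Sum>x \<in> A. F x) = (\<Sum>x \<in> A. tmult t (F x))"
proof -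
  have [simp]: "tmult 0 t = 0" "tmult t 0 = 0" by (auto simp: tmult_def case_prod_unfold)
  show "tmult (\<Sum>x \<in> A. F x) t = (\<Sum>x \<in> A. tmult (F x) t)"
    and "tmult t (\<Sum>x \<in> A. F x) = (\<Sum>x \<in> A. tmult t (F x))"
    by (induction A rule: infinite_finite_induct) (auto simp: tmult_add_left tmult_add_right)
qed

lemma tmult_delta: "tmult (delta p) (delta q) = delta (fst p @ fst q, snd p @ snd q)"
proof
  fix r :: "mon \<times> mon"
  have "tmult (delta p) (delta q) r =
    (\<Sum>(a1, a2) \<in> splits (fst r). \<Sum>(b1, b2) \<in> splits (snd r).
      if b1 = snd p \<and> b2 = snd q then if a1 = fst p \<and> a2 = fst q then 1 else 0 else 0)"
    unfolding tmult_def case_prod_unfold by (intro sum.cong refl) (auto simp: delta_def prod_eq_iff)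
  also have "\<dots> = (\<Sum>(a1, a2) \<in> splits (fst r).
      if a1 = fst p \<and> a2 = fst q then if snd r = snd p @ snd q then 1 else 0 else 0)"
    by (rule sum.cong[OF refl], clarify, subst sum_splits_delta) simp
  also have "\<dots> = delta (fst p @ fst q, snd p @ snd q) r"
    by (simp only: sum_splits_delta) (auto simp: delta_def prod_eq_iff)
  finally show "tmult (delta p) (delta q) r = delta (fst p @ fst q, snd p @ snd q) r" .
qed

lemma tmult_expand:
  assumes "s \<in> fs D" and "t \<in> fs E"
  shows "tmult s t = lin (\<lambda>p. lin (\<lambda>q. delta (fst p @ fst q, snd p @ snd q)) t) s"
proof -
  have "tmult s t = tmult (lin delta s) (lin delta t)" using assms by (simp add: lin_delta_id)
  also have "\<dots> = lin (\<lambda>p. tmult (delta p) (lin delta t)) s"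
    by (simp add: lin_def tmult_sum_left tmult_smult_left)
  also have "\<dots> = lin (\<lambda>p. lin (\<lambda>q. delta (fst p @ fst q, snd p @ snd q)) t) s"
    by (simp add: lin_def tmult_sum_right tmult_smult_right tmult_delta)
  finally show ?thesis .
qed

lemma fs_tmult:
  assumes "s \<in> fs D" and "t \<in> fs E"
    and "\<And>p q. p \<in> D \<Longrightarrow> q \<in> E \<Longrightarrow> (fst p @ fst q, snd p @ snd q) \<in> C"
  shows "tmult s t \<in> fs C"
  unfolding tmult_expand[OF assms(1,2)]
  by (intro fs_lin fs_delta assms(3)) (use assms(1,2) in \<open>auto simp: fs_def\<close>)

lemma lin_tmult:
  assumes "s \<in> fs D" and "t \<in> fs E"
  shows "lin F (tmult s t) = lin (\<lambda>p. lin (\<lambda>q. F (fst p @ fst q, snd p @ snd q)) t) s"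
  unfolding tmult_expand[OF assms]
  by (subst lin_lin[where D = UNIV], simp add: fs_lin fs_delta)
     (subst lin_lin[where D = UNIV], auto simp: fs_delta)

lemma tens_sum_left: "tens (\<Sum>x \<in> A. F x) g = (\<Sum>x \<in> A. tens (F x) g)"
  by (auto simp: tens_def sum_fun_apply sum_distrib_right)

lemma lin_tens:
  assumes "f \<in> fs D" and "g \<in> fs E"
  shows "lin (\<lambda>p. amult (F (fst p)) (G (snd p))) (tens f g) = amult (lin F f) (lin G g)"
proof -
  have "supp (tens f g) = supp f \<times> supp g" by (auto simp: supp_def tens_def)
  then have "lin (\<lambda>p. amult (F (fst p)) (G (snd p))) (tens f g) =
      (\<Sum>a \<in> supp f. \<Sum>b \<in> supp g. smult (f a * g b) (amult (F a) (G b)))"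
    by (simp add: lin_def sum.cartesian_product case_prod_unfold tens_def)
  also have "\<dots> = (\<Sum>a \<in> supp f. amult (smult (f a) (F a)) (lin G g))"
    by (simp add: lin_def mul_sum_right amult_smult_left amult_smult_right smult_sum mult.commute)
  also have "\<dots> = amult (lin F f) (lin G g)" by (simp add: lin_def mul_sum_left)
  finally show ?thesis .
qed

text \<open>Turns the antipode equations into statements about linear extensions, which
  \<open>lin_tens\<close> evaluates on pure tensors.\<close>

lemma mu_tmap: "mu (tmap S T t) = lin (\<lambda>p. amult (S (monom (fst p))) (T (monom (snd p)))) t"
proof -
  have add: "mu (s + s') = mu s + mu s'" for s s'
    by (auto simp: mu_def case_prod_unfold sum.distrib)
  have "mu 0 = 0" by (auto simp: mu_def case_prod_unfold)
  with add have sum: "mu (\<Sum>x \<in> A. F x) = (\<Sum>x \<in> A. mu (F x))" for A and F :: "mon \<times> mon \<Rightarrow> ten"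
    by (induction A rule: infinite_finite_induct) auto
  have "mu (smult c (tens f g)) = smult c (amult f g)" for c f g
    by (auto simp: mu_def smult_def tens_def amult_def case_prod_unfold sum_distrib_left)
  with sum show ?thesis by (simp add: tmap_def lin_def)
qed

section \<open>The coproduct as a matrix coproduct\<close>

text \<open>Unlike \<open>Yel\<close>, this vanishes on the empty word, which is never a block.\<close>

definition gen_elt :: "nat \<Rightarrow> nat list \<Rightarrow> alg" where
  "gen_elt i u = (if u = [] then 0 else Yel i u)"

abbreviation gen_mat :: "nat list \<Rightarrow> nat list \<Rightarrow> alg" where
  "gen_mat \<equiv> wmat amult one gen_elt"

definition valid :: "nat \<Rightarrow> mon set" where
  "valid N = {m. set m \<subseteq> gens N}"

text \<open>The grading in which Y_u^i has degree |u| - 1: it makes the coproduct homogeneous and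
  agrees with degree 0 for the unit Y_i^i.\<close>

definition deg :: "mon \<Rightarrow> nat" where
  "deg m = (\<Sum>g \<leftarrow> m. length (snd g) - 1)"

lemma H_eq: "H N = fs (valid N)"
  by (auto simp: H_def fs_def valid_def)

lemma gen_elt_Nil [simp]: "gen_elt i [] = 0"
  and gen_elt_single: "gen_elt i [j] = (if i = j then one else 0)"
  and gen_elt_long: "2 \<le> length u \<Longrightarrow> gen_elt i u = delta [(i, u)]"
  by (auto simp: gen_elt_def Yel_def monom_delta zero_fun_def)

lemma word_cases:
  obtains "u = []" | j where "u = [j]" | "2 \<le> length u"
  by (cases u rule: remdups_adj.cases) auto

lemma fs_gen_elt:
  assumes "i \<in> {1..N}" and "set u \<subseteq> {1..N}"
  shows "gen_elt i u \<in> fs {m \<in> valid N. Suc (deg m) = length u}"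
proof (cases u rule: word_cases)
  case (2 j)
  then show ?thesis by (auto simp: gen_elt_single one_delta valid_def deg_def intro: fs_delta)
next
  case 3
  then show ?thesis using assms
    by (auto simp: gen_elt_long valid_def gens_def deg_def intro!: fs_delta)
qed simp

lemma fs_UNIV_gen_elt: "gen_elt i u \<in> fs UNIV"
  by (cases u rule: word_cases) (auto simp: gen_elt_single gen_elt_long one_delta intro: fs_delta)

text \<open>A block of length l contributes degree l - 1, so the total is |u| - |v|.\<close>

lemma fs_gen_mat:
  assumes "set u \<subseteq> {1..N}" and "set v \<subseteq> {1..N}"
  shows "gen_mat u v \<in> fs {m \<in> valid N. deg m + length v = length u}"
  using assms
proof (induction v arbitrary: u)
  case Nil
  then show ?case by (auto simp: one_delta valid_def deg_def intro!: fs_delta)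
next
  case (Cons j v)
  show ?case unfolding wmat.simps
  proof (intro fs_sum, clarify)
    fix a b assume ab: "(a, b) \<in> splits u"
    then have set_ab: "set a \<subseteq> {1..N}" "set b \<subseteq> {1..N}" and u: "u = a @ b"
      using Cons.prems by (auto simp: splits_def)
    show "amult (gen_elt j a) (gen_mat b v) \<in> fs {m \<in> valid N. deg m + length (j # v) = length u}"
    proof (rule fs_amult)
      show "gen_elt j a \<in> fs {m \<in> valid N. Suc (deg m) = length a}"
        using Cons.prems set_ab by (intro fs_gen_elt) auto
      show "gen_mat b v \<in> fs {m \<in> valid N. deg m + length v = length b}"
        using Cons.prems set_ab by (intro Cons.IH) auto
    qed (auto simp: u valid_def deg_def)
  qed
qed

lemma fs_UNIV_wmat:
  assumes "\<And>f g. f \<in> fs UNIV \<Longrightarrow> g \<in> fs UNIV \<Longrightarrow> mul f g \<in> fs UNIV"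
    and "e \<in> fs UNIV" and "\<And>j a. x j a \<in> fs UNIV"
  shows "wmat mul e x u v \<in> fs UNIV"
  using assms by (induction v arbitrary: u) (auto intro!: fs_sum)

lemma finite_compositions: "finite (compositions p q)"
proof (rule finite_subset)
  show "compositions p q \<subseteq> {ks. set ks \<subseteq> {..p} \<and> length ks = q}"
    by (auto simp: compositions_def intro: member_le_sum_list)
  show "finite {ks. set ks \<subseteq> {..p} \<and> length ks = q}" by (rule finite_lists_length_eq) simp
qed

text \<open>Bridge from the coproduct formula to \<open>wmat\<close>: peeling off the first block
  turns a composition into a cut of \<open>u\<close> and a shorter composition.\<close>

lemma sum_compositions:
  "(\<Sum>ks \<in> compositions (length u) (length v).
      foldr amult (map (\<lambda>(j, w). Yel j w) (zip v (chop ks u))) one) = gen_mat u v"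
proof (induction v arbitrary: u)
  case Nil
  have "compositions (length u) 0 = (if u = [] then {[]} else {})"
    by (auto simp: compositions_def)
  then show ?case by (auto simp: zero_fun_def)
next
  case (Cons j v)
  let ?f = "\<lambda>v ks u. foldr amult (map (\<lambda>(j, w). Yel j w) (zip v (chop ks u))) one"
  let ?S = "{ab \<in> splits u. fst ab \<noteq> []}"
  let ?C = "\<lambda>ab. compositions (length (snd ab)) (length v)"
  have "gen_mat u (j # v) = (\<Sum>ab \<in> splits u. amult (gen_elt j (fst ab)) (\<Sum>ks \<in> ?C ab. ?f v ks (snd ab)))"
    unfolding wmat.simps Cons.IH by (simp add: case_prod_unfold)
  \<comment> \<open>Compositions have positive parts; accordingly an empty first piece carries the
    factor \<open>gen_elt j [] = 0\<close>.\<close>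
  also have "\<dots> = (\<Sum>ab \<in> ?S. amult (gen_elt j (fst ab)) (\<Sum>ks \<in> ?C ab. ?f v ks (snd ab)))"
    by (rule sum.mono_neutral_right) auto
  also have "\<dots> = (\<Sum>ab \<in> ?S. \<Sum>ks \<in> ?C ab. amult (Yel j (fst ab)) (?f v ks (snd ab)))"
    by (intro sum.cong refl) (simp add: mul_sum_right gen_elt_def)
  also have "\<dots> = (\<Sum>(ab, ks) \<in> Sigma ?S ?C. amult (Yel j (fst ab)) (?f v ks (snd ab)))"
    by (subst sum.Sigma) (auto simp: finite_compositions)
  also have "\<dots> = (\<Sum>ks \<in> compositions (length u) (length (j # v)). ?f (j # v) ks u)"
    by (rule sum.reindex_bij_witness[of _
          "\<lambda>ks. ((take (hd ks) u, drop (hd ks) u), tl ks)" "\<lambda>(ab, ks). length (fst ab) # ks"])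
       (auto simp: splits_def compositions_def length_Suc_conv)
  finally show ?case by simp
qed

text \<open>The sums over q and over words of length q merge into one; the empty word may be
  included because \<open>gen_elt i [] = 0\<close>.\<close>

lemma Dgen_eq:
  "Dgen N (i, u) = (\<Sum>v \<in> words_le N (length u). tens (gen_mat u v) (gen_elt i v))"
proof -
  let ?W = "words_le N (length u)"
  have words: "words N q = {v \<in> ?W - {[]}. length v = q}" if "q \<in> {1..length u}" for q
    using that by (auto simp: words_def words_le_def)
  have "Dgen N (i, u) = (\<Sum>q \<in> {1..length u}. \<Sum>v \<in> words N q.
      tens (\<Sum>ks \<in> compositions (length u) q.
        foldr amult (map (\<lambda>(j, w). Yel j w) (zip v (chop ks u))) one) (Yel i v))"
    by (simp add: Dgen_def tens_sum_left sum.swap[of _ _ "words N _"])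
  also have "\<dots> = (\<Sum>q \<in> {1..length u}. \<Sum>v \<in> words N q. tens (gen_mat u v) (Yel i v))"
  proof (intro sum.cong refl)
    fix q v assume "v \<in> words N q"
    then have "q = length v" by (simp add: words_def)
    then show "tens (\<Sum>ks \<in> compositions (length u) q.
        foldr amult (map (\<lambda>(j, w). Yel j w) (zip v (chop ks u))) one) (Yel i v) =
      tens (gen_mat u v) (Yel i v)"
      by (simp only: sum_compositions)
  qed
  also have "\<dots> = (\<Sum>q \<in> {1..length u}. \<Sum>v \<in> {v \<in> ?W - {[]}. length v = q}. tens (gen_mat u v) (gen_elt i v))"
  proof (intro sum.cong words)
    fix q v assume "q \<in> {1..length u}" and "v \<in> {v \<in> ?W - {[]}. length v = q}"
    then show "tens (gen_mat u v) (Yel i v) = tens (gen_mat u v) (gen_elt i v)"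
      by (simp add: gen_elt_def)
  qed auto
  also have "\<dots> = (\<Sum>v \<in> ?W - {[]}. tens (gen_mat u v) (gen_elt i v))"
    by (rule sum.group) (simp, simp, auto simp: words_le_def Suc_le_eq)
  also have "\<dots> = (\<Sum>v \<in> ?W. tens (gen_mat u v) (gen_elt i v))"
    by (rule sum.mono_neutral_left) (auto simp: tens_def)
  finally show ?thesis .
qed

section \<open>Grading and triangularity of the coproduct\<close>

definition bideg :: "nat \<Rightarrow> nat \<Rightarrow> (mon \<times> mon) set" where
  "bideg N d = {p. fst p \<in> valid N \<and> snd p \<in> valid N \<and> deg (fst p) + deg (snd p) = d}"

text \<open>The two factors at \<open>v\<close> have degrees |u| - |v| and |v| - 1, whose sum is
  independent of \<open>v\<close>.\<close>

lemma fs_Dgen: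
  assumes "g \<in> gens N"
  shows "Dgen N g \<in> fs (bideg N (deg [g]))"
proof -
  obtain i u where g: "g = (i, u)" by (cases g)
  then have i: "i \<in> {1..N}" and u: "set u \<subseteq> {1..N}" "2 \<le> length u" using assms by (auto simp: gens_def)
  have "tens (gen_mat u v) (gen_elt i v) \<in> fs (bideg N (deg [g]))" if "v \<in> words_le N (length u)" for v
  proof -
    have v: "set v \<subseteq> {1..N}" using that by (simp add: words_le_def)
    have "{m \<in> valid N. deg m + length v = length u} \<times> {m \<in> valid N. Suc (deg m) = length v} \<subseteq>
        bideg N (deg [g])"
      by (auto simp: bideg_def g deg_def)
    then show ?thesis by (rule fs_mono) (intro fs_tens fs_gen_mat fs_gen_elt i u v)
  qed
  then show ?thesis unfolding g Dgen_eq by (intro fs_sum)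
qed

lemma fs_Dmon:
  assumes "m \<in> valid N"
  shows "Dmon N m \<in> fs (bideg N (deg m))"
  using assms
proof (induction m)
  case Nil
  have "tens one one \<in> fs ({[]} \<times> {[]})" unfolding one_delta by (intro fs_tens fs_delta) auto
  moreover have "{[]} \<times> {[]} \<subseteq> bideg N (deg [])" by (auto simp: bideg_def valid_def deg_def)
  ultimately show ?case unfolding Dmon.simps by (metis fs_mono)
next
  case (Cons g m)
  then have "Dgen N g \<in> fs (bideg N (deg [g]))" "Dmon N m \<in> fs (bideg N (deg m))"
    by (auto simp: valid_def fs_Dgen)
  then show ?case unfolding Dmon.simps
    by (rule fs_tmult) (auto simp: bideg_def valid_def deg_def)
qed

text \<open>A constant term in the right factor comes only from \<open>v = [i]\<close>, whose left
  factor is the generator itself. This triangularity drives the uniqueness of the antipode.\<close>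

lemma Dgen_Nil:
  assumes "g \<in> gens N"
  shows "Dgen N g (a, []) = (if a = [g] then 1 else 0)"
proof -
  obtain i u where g: "g = (i, u)" by (cases g)
  then have i: "i \<in> {1..N}" and u: "set u \<subseteq> {1..N}" "2 \<le> length u" using assms by (auto simp: gens_def)
  have elt: "gen_elt i v [] = (if v = [i] then 1 else 0)" for v
    by (cases v rule: word_cases) (auto simp: gen_elt_single gen_elt_long one_delta delta_def)
  have "Dgen N g (a, []) = (\<Sum>v \<in> words_le N (length u). if v = [i] then gen_elt i u a else 0)"
    unfolding g Dgen_eq sum_fun_apply
    by (intro sum.cong refl) (simp add: tens_def elt wmat_single del: wmat.simps)
  also have "\<dots> = gen_elt i u a"
    using i u by (simp only: sum.delta finite_words_le) (auto simp: words_le_def)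
  also have "\<dots> = (if a = [g] then 1 else 0)" using u by (simp add: gen_elt_long delta_def g)
  finally show ?thesis .
qed

lemma Dmon_Nil:
  assumes "m \<in> valid N"
  shows "Dmon N m (a, []) = (if a = m then 1 else 0)"
  using assms
proof (induction m arbitrary: a)
  case Nil
  then show ?case by (simp add: tens_def one_delta delta_def)
next
  case (Cons g m)
  then have "Dmon N (g # m) (a, []) = (\<Sum>(a1, a2) \<in> splits a. if a1 = [g] \<and> a2 = m then 1 else 0)"
    by (auto simp: tmult_def valid_def Dgen_Nil intro!: sum.cong)
  then show ?case by (simp only: sum_splits_delta) simp
qed

lemma deg_pos:
  assumes "m \<in> valid N" and "m \<noteq> []"
  shows "0 < deg m"
  using assms by (cases m) (auto simp: deg_def valid_def gens_def)

lemma Delta_lin: "Delta N f = lin (Dmon N) f"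
  by (simp add: Delta_def lin_def)

lemma mu_tmap_Delta:
  assumes "f \<in> H N"
  shows "mu (tmap S T (Delta N f)) =
    lin (\<lambda>m. lin (\<lambda>p. amult (S (monom (fst p))) (T (monom (snd p)))) (Dmon N m)) f"
  unfolding mu_tmap Delta_lin
  using assms by (intro lin_lin[where D = UNIV]) (auto simp: H_eq fs_def[of "valid N"] intro: fs_UNIV fs_Dmon)

section \<open>Anti-homomorphisms and the antipode\<close>

lemma lin_monom: "f \<in> fs D \<Longrightarrow> lin monom f = f"
  using lin_delta_id[of f D] monom_delta by (metis ext)

text \<open>Anti-multiplicative extension from generators to monomials.\<close>

fun anti :: "(nat \<Rightarrow> nat list \<Rightarrow> alg) \<Rightarrow> mon \<Rightarrow> alg" where
  "anti s [] = one"
| "anti s (g # m) = amult (anti s m) (s (fst g) (snd g))"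

lemma anti_append: "anti s (a @ b) = amult (anti s b) (anti s a)"
  by (induction a) (auto simp: assoc)

lemma lin_anti_amult:
  assumes "f \<in> fs D" and "g \<in> fs E"
  shows "lin (anti s) (amult f g) = amult (lin (anti s) g) (lin (anti s) f)"
  by (simp add: lin_amult[OF assms] anti_append lin_amult_left lin_amult_right)

lemma lin_anti_gen_elt:
  assumes "s i [] = 0" and "\<And>j. s i [j] = (if i = j then one else 0)"
  shows "lin (anti s) (gen_elt i u) = s i u"
  by (cases u rule: word_cases) (auto simp: assms gen_elt_single gen_elt_long one_delta[symmetric]
      simp del: zero_fun_apply, simp add: one_delta)

text \<open>Reversing every product exchanges the matrix for the concatenation product with the one
  for its opposite.\<close>

lemma lin_anti_wmat:
  assumes "\<And>j a. x j a \<in> fs UNIV"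
  shows "lin (anti s) (wmat amult one x u v) =
    wmat (\<lambda>a b. amult b a) one (\<lambda>j a. lin (anti s) (x j a)) u v"
proof (induction v arbitrary: u)
  case (Cons j v)
  have fs: "wmat amult one x b v \<in> fs UNIV" for b
    by (intro fs_UNIV_wmat fs_UNIV_amult fs_UNIV_one assms)
  then have "lin (anti s) (wmat amult one x u (j # v)) =
      (\<Sum>ab \<in> splits u. lin (anti s) (amult (x j (fst ab)) (wmat amult one x (snd ab) v)))"
    unfolding wmat.simps case_prod_unfold
    by (intro lin_sum[where D = UNIV] fs_UNIV_amult assms)
  also have "\<dots> = wmat (\<lambda>a b. amult b a) one (\<lambda>j a. lin (anti s) (x j a)) u (j # v)"
    by (simp add: lin_anti_amult[OF assms fs] Cons.IH case_prod_unfold)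
  finally show ?case .
qed (simp add: one_delta)

lemma lin_anti_wmat_opposite:
  assumes "\<And>j a. x j a \<in> fs UNIV"
  shows "lin (anti s) (wmat (\<lambda>a b. amult b a) one x u v) =
    wmat amult one (\<lambda>j a. lin (anti s) (x j a)) u v"
proof (induction v arbitrary: u)
  case (Cons j v)
  have fs: "wmat (\<lambda>a b. amult b a) one x b v \<in> fs UNIV" for b
    by (intro fs_UNIV_wmat fs_UNIV_amult fs_UNIV_one assms)
  then have "lin (anti s) (wmat (\<lambda>a b. amult b a) one x u (j # v)) =
      (\<Sum>ab \<in> splits u. lin (anti s) (amult (wmat (\<lambda>a b. amult b a) one x (snd ab) v) (x j (fst ab))))"
    unfolding wmat.simps case_prod_unfold
    by (intro lin_sum[where D = UNIV] fs_UNIV_amult assms)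
  also have "\<dots> = wmat amult one (\<lambda>j a. lin (anti s) (x j a)) u (j # v)"
    by (simp add: lin_anti_amult[OF fs assms] Cons.IH case_prod_unfold)
  finally show ?case .
qed (simp add: one_delta)

text \<open>The values on generators of the antipode and of its inverse: both recursions multiply the
  subtrees from right to left, the former with the root last, the latter with the root first.\<close>

definition antipode_gen :: "nat \<Rightarrow> nat \<Rightarrow> nat list \<Rightarrow> alg" where
  "antipode_gen N = tree_sum (\<lambda>i v X. amult X (gen_elt i v)) (\<lambda>a b. amult b a) one N"

definition inverse_gen :: "nat \<Rightarrow> nat \<Rightarrow> nat list \<Rightarrow> alg" where
  "inverse_gen N = tree_sum (\<lambda>i v X. amult (gen_elt i v) X) (\<lambda>a b. amult b a) one N"

lemma antipode_gen_Nil: "antipode_gen N i [] = 0"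
  and inverse_gen_Nil: "inverse_gen N i [] = 0"
  by (simp_all only: antipode_gen_def inverse_gen_def tree_sum_Nil)

lemma fs_valid_amult: "f \<in> fs (valid N) \<Longrightarrow> g \<in> fs (valid N) \<Longrightarrow> amult f g \<in> fs (valid N)"
  by (rule fs_amult) (auto simp: valid_def)

lemma fs_tree_weight:
  assumes "\<And>c v X. c \<in> {1..N} \<Longrightarrow> set v \<subseteq> {1..N} \<Longrightarrow> X \<in> fs (valid N) \<Longrightarrow> \<phi> c v X \<in> fs (valid N)"
    and "colours_ok N T"
  shows "tree_weight \<phi> (\<lambda>a b. amult b a) one T \<in> fs (valid N)"
  using assms(2)
proof (induction T)
  case (Node c ts)
  let ?w = "tree_weight \<phi> (\<lambda>a b. amult b a) one"
  have one: "one \<in> fs (valid N)" by (simp add: one_delta valid_def fs_delta)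
  have prod: "foldr (\<lambda>a b. amult b a) (map ?w xs) one \<in> fs (valid N)" if "set xs \<subseteq> set ts" for xs
    using that Node by (induction xs) (auto intro!: fs_valid_amult one)
  have roots: "set (map root ts) \<subseteq> {1..N}"
  proof
    fix j assume "j \<in> set (map root ts)"
    then obtain T where "T \<in> set ts" "j = root T" by auto
    with Node.prems show "j \<in> {1..N}" by (cases T) auto
  qed
  show ?case
  proof (cases "ts = []")
    case False
    then show ?thesis
      unfolding tree_weight_Node[OF False] using Node.prems
      by (intro fs_uminus assms(1) roots prod) auto
  qed (simp add: one)
qed

lemma fs_tree_sum:
  assumes "\<And>c v X. c \<in> {1..N} \<Longrightarrow> set v \<subseteq> {1..N} \<Longrightarrow> X \<in> fs (valid N) \<Longrightarrow> \<phi> c v X \<in> fs (valid N)"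
  shows "tree_sum \<phi> (\<lambda>a b. amult b a) one N i u \<in> fs (valid N)"
  unfolding tree_sum_def by (intro fs_sum fs_tree_weight assms) (auto simp: RT_def)

lemma fs_valid_gen_elt: "i \<in> {1..N} \<Longrightarrow> set u \<subseteq> {1..N} \<Longrightarrow> gen_elt i u \<in> fs (valid N)"
  by (rule fs_mono[OF _ fs_gen_elt]) auto

lemma fs_antipode_gen: "antipode_gen N i u \<in> fs (valid N)"
  unfolding antipode_gen_def by (intro fs_tree_sum fs_valid_amult fs_valid_gen_elt)

lemma fs_inverse_gen: "inverse_gen N i u \<in> fs (valid N)"
  unfolding inverse_gen_def by (intro fs_tree_sum fs_valid_amult fs_valid_gen_elt)

lemmas fs_UNIV_antipode_gen = fs_antipode_gen[THEN fs_UNIV]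
  and fs_UNIV_inverse_gen = fs_inverse_gen[THEN fs_UNIV]

section \<open>Inverse matrices from tree sums\<close>

text \<open>Root splitting with the root generator on the right: P M = 1 on one-letter
  columns.\<close>

lemma antipode_gen_eq:
  assumes "u \<in> words_le N n" and "i \<in> {1..N}" and "1 \<le> n"
  shows "(\<Sum>v \<in> words_le N n.
      amult (wmat (\<lambda>a b. amult b a) one (antipode_gen N) u v) (gen_elt i v)) =
    (if u = [i] then one else 0)"
  unfolding antipode_gen_def
  by (rule ring_ops.tree_sum_inverse[OF opposite, where \<phi> = "\<lambda>i v X. amult X (gen_elt i v)"])
     (use assms in \<open>simp_all add: distrib_right gen_elt_single del: plus_fun_apply zero_fun_apply\<close>)

text \<open>Root splitting with the root generator on the left, which gives the equation for
  T.\<close>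

lemma inverse_gen_eq:
  assumes "u \<in> words_le N n" and "i \<in> {1..N}" and "1 \<le> n"
  shows "(\<Sum>v \<in> words_le N n.
      amult (gen_elt i v) (wmat (\<lambda>a b. amult b a) one (inverse_gen N) u v)) =
    (if u = [i] then one else 0)"
  unfolding inverse_gen_def
  by (rule ring_ops.tree_sum_inverse[OF opposite, where \<phi> = "\<lambda>i v X. amult (gen_elt i v) X"])
     (use assms in \<open>simp_all add: distrib_left gen_elt_single del: plus_fun_apply zero_fun_apply\<close>)

abbreviation antipode_lin :: "nat \<Rightarrow> alg \<Rightarrow> alg" where
  "antipode_lin N \<equiv> lin (anti (antipode_gen N))"

abbreviation inverse_lin :: "nat \<Rightarrow> alg \<Rightarrow> alg" where
  "inverse_lin N \<equiv> lin (anti (inverse_gen N))"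

lemma antipode_lin_gen_elt: "i \<in> {1..N} \<Longrightarrow> antipode_lin N (gen_elt i u) = antipode_gen N i u"
  and inverse_lin_gen_elt: "i \<in> {1..N} \<Longrightarrow> inverse_lin N (gen_elt i u) = inverse_gen N i u"
  by (simp_all only: lin_anti_gen_elt antipode_gen_def inverse_gen_def tree_sum_Nil tree_sum_single)

text \<open>The anti-homomorphism is applied to the equation for T: products turn around,
  \<open>gen_elt\<close> becomes \<open>antipode_gen\<close>, and S(T) P = 1 results on one-letter
  columns.\<close>

lemma antipode_lin_inverse_gen_eq:
  assumes "u \<in> words_le N n" and "i \<in> {1..N}" and "1 \<le> n"
  shows "(\<Sum>v \<in> words_le N n.
      amult (wmat amult one (\<lambda>j a. antipode_lin N (inverse_gen N j a)) u v) (antipode_gen N i v)) =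
    (if u = [i] then one else 0)"
proof -
  let ?T = "wmat (\<lambda>a b. amult b a) one (inverse_gen N)"
  have fs: "?T u v \<in> fs UNIV" for v
    by (intro fs_UNIV_wmat fs_UNIV_amult fs_UNIV_one fs_UNIV_inverse_gen)
  have "(\<Sum>v \<in> words_le N n.
      amult (wmat amult one (\<lambda>j a. antipode_lin N (inverse_gen N j a)) u v) (antipode_gen N i v)) =
    (\<Sum>v \<in> words_le N n. antipode_lin N (amult (gen_elt i v) (?T u v)))"
    using assms(2) fs by (simp only: lin_anti_amult[OF fs_UNIV_gen_elt fs] antipode_lin_gen_elt
        lin_anti_wmat_opposite[OF fs_UNIV_inverse_gen])
  also have "\<dots> = antipode_lin N (\<Sum>v \<in> words_le N n. amult (gen_elt i v) (?T u v))"
    by (rule lin_sum[where D = UNIV, symmetric]) (intro fs_UNIV_amult fs_UNIV_gen_elt fs)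
  also have "\<dots> = (if u = [i] then one else 0)"
    unfolding inverse_gen_eq[OF assms] by (simp add: one_delta del: zero_fun_apply)
  finally show ?thesis .
qed

text \<open>The same with exchanged roles: the candidate for the inverse is applied to P M =
  1.\<close>

lemma inverse_lin_antipode_gen_eq:
  assumes "u \<in> words_le N n" and "i \<in> {1..N}" and "1 \<le> n"
  shows "(\<Sum>v \<in> words_le N n.
      amult (inverse_gen N i v) (wmat amult one (\<lambda>j a. inverse_lin N (antipode_gen N j a)) u v)) =
    (if u = [i] then one else 0)"
proof -
  let ?P = "wmat (\<lambda>a b. amult b a) one (antipode_gen N)"
  have fs: "?P u v \<in> fs UNIV" for v
    by (intro fs_UNIV_wmat fs_UNIV_amult fs_UNIV_one fs_UNIV_antipode_gen)
  have "(\<Sum>v \<in> words_le N n.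
      amult (inverse_gen N i v) (wmat amult one (\<lambda>j a. inverse_lin N (antipode_gen N j a)) u v)) =
    (\<Sum>v \<in> words_le N n. inverse_lin N (amult (?P u v) (gen_elt i v)))"
    using assms(2) fs by (simp only: lin_anti_amult[OF fs fs_UNIV_gen_elt] inverse_lin_gen_elt
        lin_anti_wmat_opposite[OF fs_UNIV_antipode_gen])
  also have "\<dots> = inverse_lin N (\<Sum>v \<in> words_le N n. amult (?P u v) (gen_elt i v))"
    by (rule lin_sum[where D = UNIV, symmetric]) (intro fs_UNIV_amult fs_UNIV_gen_elt fs)
  also have "\<dots> = (if u = [i] then one else 0)"
    unfolding antipode_gen_eq[OF assms] by (simp add: one_delta del: zero_fun_apply)
  finally show ?thesis .
qed

text \<open>S(T) is a left and M a right inverse of P.\<close>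

lemma antipode_lin_inverse_mat:
  assumes "u \<in> words_le N n" and "w \<in> words_le N n" and "1 \<le> n"
  shows "wmat amult one (\<lambda>j a. antipode_lin N (inverse_gen N j a)) u w = gen_mat u w"
  by (rule wmat_opposite_inverses_equal[where s = "antipode_gen N" and N = N and n = n])
     (use assms in \<open>simp_all only: inverse_gen_Nil antipode_gen_Nil lin_zero
        antipode_lin_inverse_gen_eq antipode_gen_eq\<close>)

lemma inverse_lin_antipode_mat:
  assumes "u \<in> words_le N n" and "w \<in> words_le N n" and "1 \<le> n"
  shows "wmat amult one (\<lambda>j a. inverse_lin N (antipode_gen N j a)) u w = gen_mat u w"
  by (rule wmat_opposite_inverses_equal'[where t = "inverse_gen N" and N = N and n = n])
     (use assms in \<open>simp_all only: inverse_gen_Nil antipode_gen_Nil lin_zero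
        inverse_lin_antipode_gen_eq inverse_gen_eq\<close>)

lemma antipode_lin_inverse_gen:
  assumes "i \<in> {1..N}" and "set u \<subseteq> {1..N}"
  shows "antipode_lin N (inverse_gen N i u) = gen_elt i u"
  \<comment> \<open>The bound exceeds |u| by one, so that \<open>[i]\<close> fits even when
    \<open>u\<close> is empty.\<close>
  using antipode_lin_inverse_mat[of u N "Suc (length u)" "[i]"] assms
  by (simp add: words_le_def wmat_single del: wmat.simps)

lemma inverse_lin_antipode_gen:
  assumes "i \<in> {1..N}" and "set u \<subseteq> {1..N}"
  shows "inverse_lin N (antipode_gen N i u) = gen_elt i u"
  using inverse_lin_antipode_mat[of u N "Suc (length u)" "[i]"] assms
  by (simp add: words_le_def wmat_single del: wmat.simps)

lemma fs_anti_antipode_gen: "anti (antipode_gen N) m \<in> fs (valid N)"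
proof (induction m)
  case Nil
  then show ?case by (simp add: one_delta valid_def fs_delta)
qed (simp add: fs_valid_amult fs_antipode_gen)

text \<open>Two reversals restore the order of the letters, and
  \<open>inverse_lin_antipode_gen\<close> restores each letter.\<close>

lemma inverse_lin_anti:
  assumes "m \<in> valid N"
  shows "inverse_lin N (anti (antipode_gen N) m) = monom m"
  using assms
proof (induction m)
  case (Cons g m)
  obtain i u where g: "g = (i, u)" by (cases g)
  with Cons.prems have g': "i \<in> {1..N}" "set u \<subseteq> {1..N}" "2 \<le> length u" and m: "m \<in> valid N"
    by (auto simp: valid_def gens_def)
  have "inverse_lin N (anti (antipode_gen N) (g # m)) =
      amult (inverse_lin N (antipode_gen N i u)) (inverse_lin N (anti (antipode_gen N) m))"
    by (simp add: g lin_anti_amult[OF fs_anti_antipode_gen fs_antipode_gen])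
  also have "\<dots> = amult (delta [g]) (delta m)"
    using g' by (simp only: inverse_lin_antipode_gen Cons.IH[OF m] gen_elt_long g monom_delta)
  finally show ?case by (simp add: amult_delta monom_delta)
qed (simp add: one_delta monom_delta)

text \<open>Gives injectivity of the antipode, on which the definite description in
  \<open>S_L\<close> relies.\<close>

lemma inverse_lin_antipode_lin:
  assumes "f \<in> fs (valid N)"
  shows "inverse_lin N (antipode_lin N f) = f"
proof -
  have "inverse_lin N (antipode_lin N f) = lin (\<lambda>m. inverse_lin N (anti (antipode_gen N) m)) f"
    by (intro lin_lin[where D = "valid N"] fs_anti_antipode_gen)
  also have "\<dots> = lin monom f"
    by (rule lin_cong) (use assms in \<open>auto simp: fs_def intro!: inverse_lin_anti\<close>)
  finally show ?thesis using lin_monom[OF assms] by simp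
qed

section \<open>The antipode equations on generators and monomials\<close>

lemma lin_Dgen:
  "lin (\<lambda>p. amult (F (fst p)) (G (snd p))) (Dgen N (i, u)) =
    (\<Sum>v \<in> words_le N (length u). amult (lin F (gen_mat u v)) (lin G (gen_elt i v)))"
proof -
  have fs: "gen_mat u v \<in> fs UNIV" for v
    by (intro fs_UNIV_wmat fs_UNIV_amult fs_UNIV_one fs_UNIV_gen_elt)
  show ?thesis unfolding Dgen_eq
    by (subst lin_sum[where D = UNIV])
       (simp_all add: lin_tens[OF fs fs_UNIV_gen_elt] fs_tens[OF fs fs_UNIV_gen_elt, simplified])
qed

text \<open>The convolution is an entry of P M, and |u| \<ge> 2 excludes the diagonal case
  \<open>u = [i]\<close>.\<close>

lemma lin_Dgen_left:
  assumes "g \<in> gens N"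
  shows "lin (\<lambda>p. amult (anti (antipode_gen N) (fst p)) (monom (snd p))) (Dgen N g) = 0"
proof -
  obtain i u where g: "g = (i, u)" by (cases g)
  then have i: "i \<in> {1..N}" and u: "set u \<subseteq> {1..N}" "2 \<le> length u" using assms by (auto simp: gens_def)
  have "lin (\<lambda>p. amult (anti (antipode_gen N) (fst p)) (monom (snd p))) (Dgen N g) =
    (\<Sum>v \<in> words_le N (length u). amult (antipode_lin N (gen_mat u v)) (gen_elt i v))"
    unfolding g lin_Dgen lin_monom[OF fs_UNIV_gen_elt] ..
  also have "\<dots> = (\<Sum>v \<in> words_le N (length u).
      amult (wmat (\<lambda>a b. amult b a) one (antipode_gen N) u v) (gen_elt i v))"
    unfolding lin_anti_wmat[OF fs_UNIV_gen_elt]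
    by (intro sum.cong refl arg_cong2[where f = amult] ring_ops.wmat_cong[OF opposite] antipode_lin_gen_elt)
       (auto simp: words_le_def)
  also have "\<dots> = 0"
    using u by (subst antipode_gen_eq[OF _ i]) (auto simp: words_le_def)
  finally show ?thesis .
qed

text \<open>This side asks for M P, while root splitting gives P M; writing M as S(T) turns the sum
  into S(T) P.\<close>

lemma lin_Dgen_right:
  assumes "g \<in> gens N"
  shows "lin (\<lambda>p. amult (monom (fst p)) (anti (antipode_gen N) (snd p))) (Dgen N g) = 0"
proof -
  obtain i u where g: "g = (i, u)" by (cases g)
  then have i: "i \<in> {1..N}" and u: "set u \<subseteq> {1..N}" "2 \<le> length u" using assms by (auto simp: gens_def)
  have fs: "gen_mat u v \<in> fs UNIV" for v
    by (intro fs_UNIV_wmat fs_UNIV_amult fs_UNIV_one fs_UNIV_gen_elt)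
  have uW: "u \<in> words_le N (length u)" using u by (simp add: words_le_def)
  have n: "1 \<le> length u" using u by simp
  have "lin (\<lambda>p. amult (monom (fst p)) (anti (antipode_gen N) (snd p))) (Dgen N g) =
    (\<Sum>v \<in> words_le N (length u). amult (gen_mat u v) (antipode_gen N i v))"
    unfolding g lin_Dgen lin_monom[OF fs] antipode_lin_gen_elt[OF i] ..
  also have "\<dots> = (\<Sum>v \<in> words_le N (length u).
      amult (wmat amult one (\<lambda>j a. antipode_lin N (inverse_gen N j a)) u v) (antipode_gen N i v))"
    by (intro sum.cong refl arg_cong2[where f = amult] antipode_lin_inverse_mat[symmetric])
       (use uW n in auto)
  also have "\<dots> = 0"
    using u by (subst antipode_lin_inverse_gen_eq[OF uW i n]) auto
  finally show ?thesis .
qed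

text \<open>By reversal, the two factors coming from the first letter meet in the middle of the
  product, where their convolution is 0; a case distinction suffices.\<close>

lemma lin_Dmon_left:
  assumes "m \<in> valid N"
  shows "lin (\<lambda>p. amult (anti (antipode_gen N) (fst p)) (monom (snd p))) (Dmon N m) =
    (if m = [] then one else 0)"
proof (cases m)
  case Nil
  have "Dmon N m = delta ([], [])"
    by (auto simp: Nil tens_def one_delta delta_def)
  then show ?thesis by (simp add: Nil monom_delta flip: one_delta)
next
  case (Cons g gs)
  let ?C = "\<lambda>p. amult (anti (antipode_gen N) (fst p)) (monom (snd p))"
  have g: "g \<in> gens N" and gs: "gs \<in> valid N" using assms by (auto simp: Cons valid_def)
  have C: "?C (fst p @ fst q, snd p @ snd q) =
      amult (amult (anti (antipode_gen N) (fst q)) (?C p)) (monom (snd q))" for p q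
    by (simp add: anti_append monom_delta assoc amult_delta[symmetric])
  have "lin ?C (Dmon N m) =
      lin (\<lambda>q. lin (\<lambda>p. ?C (fst p @ fst q, snd p @ snd q)) (Dgen N g)) (Dmon N gs)"
    unfolding Cons Dmon.simps lin_tmult[OF fs_Dgen[OF g] fs_Dmon[OF gs]] by (rule lin_swap)
  also have "\<dots> = 0"
    unfolding C lin_amult_left lin_amult_right lin_Dgen_left[OF g]
    by (simp only: mul_zero_left mul_zero_right lin_zero_fun)
  finally show ?thesis by (simp add: Cons del: zero_fun_apply)
qed

text \<open>On this side the factors of the tail meet in the middle, so induction replaces them by
  the counit before the first letter is treated.\<close>

lemma lin_Dmon_right:
  assumes "m \<in> valid N"
  shows "lin (\<lambda>p. amult (monom (fst p)) (anti (antipode_gen N) (snd p))) (Dmon N m) =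
    (if m = [] then one else 0)"
  using assms
proof (induction m)
  case Nil
  have "Dmon N [] = delta ([], [])"
    by (auto simp: tens_def one_delta delta_def)
  then show ?case by (simp add: monom_delta flip: one_delta)
next
  case (Cons g gs)
  let ?C = "\<lambda>p. amult (monom (fst p)) (anti (antipode_gen N) (snd p))"
  have g: "g \<in> gens N" and gs: "gs \<in> valid N" using Cons.prems by (auto simp: valid_def)
  have C: "?C (fst p @ fst q, snd p @ snd q) =
      amult (amult (monom (fst p)) (?C q)) (anti (antipode_gen N) (snd p))" for p q
    by (simp add: anti_append monom_delta assoc amult_delta[symmetric])
  have "lin ?C (Dmon N (g # gs)) =
      lin (\<lambda>p. lin (\<lambda>q. ?C (fst p @ fst q, snd p @ snd q)) (Dmon N gs)) (Dgen N g)"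
    unfolding Dmon.simps by (rule lin_tmult[OF fs_Dgen[OF g] fs_Dmon[OF gs]])
  also have "\<dots> = lin (\<lambda>p. amult (amult (monom (fst p)) (if gs = [] then one else 0))
      (anti (antipode_gen N) (snd p))) (Dgen N g)"
    unfolding C lin_amult_left lin_amult_right Cons.IH[OF gs] ..
  also have "\<dots> = 0"
  proof (cases "gs = []")
    case True
    then show ?thesis by (simp only: if_True right_unit simp_thms lin_Dgen_right[OF g])
  next
    case False
    then show ?thesis by (simp only: if_False mul_zero_left mul_zero_right lin_zero_fun)
  qed
  finally show ?case by (simp del: zero_fun_apply)
qed

section \<open>Existence of the antipode\<close>

text \<open>Set to zero outside \<open>H N\<close>, as the normalisation in \<open>S_H\<close>
  demands.\<close>

definition antipode :: "nat \<Rightarrow> alg \<Rightarrow> alg" where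
  "antipode N f = (if f \<in> H N then antipode_lin N f else 0)"

lemma antipode_monom: "m \<in> valid N \<Longrightarrow> antipode N (monom m) = anti (antipode_gen N) m"
  by (simp add: antipode_def H_eq monom_delta fs_delta)

lemma lin_unit:
  assumes "f \<in> fs D"
  shows "lin (\<lambda>m. if m = [] then one else 0) f = smult (eps f) one"
proof -
  have "lin (\<lambda>m. if m = [] then one else 0) f =
      (\<Sum>m \<in> supp f. if m = [] then smult (f m) one else 0)"
    unfolding lin_def by (intro sum.cong refl) (simp del: zero_fun_apply)
  also have "\<dots> = smult (eps f) one"
    using assms by (simp add: fs_def eps_def del: zero_fun_apply) (auto simp: supp_def)
  finally show ?thesis .
qed

lemma is_antipode_antipode: "is_antipode N (antipode N)"
  unfolding is_antipode_def
proof (intro conjI ballI allI)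
  fix f g :: alg and c
  assume f: "f \<in> H N"
  then have fs: "f \<in> fs (valid N)" by (simp add: H_eq)
  have valid: "m \<in> valid N" if "m \<in> supp f" for m
    using that fs by (auto simp: fs_def)
  have bi: "fst p \<in> valid N \<and> snd p \<in> valid N" if "m \<in> supp f" "p \<in> supp (Dmon N m)" for m p
    using fs_Dmon[OF valid[OF that(1)]] that(2) by (auto simp: fs_def bideg_def)
  show "antipode N f \<in> H N"
    using f by (simp add: antipode_def) (simp add: H_eq fs_lin fs_anti_antipode_gen)
  show "antipode N (f + g) = antipode N f + antipode N g" if "g \<in> H N"
  proof -
    have "f + g \<in> H N" using f that unfolding H_eq by (rule fs_add)
    moreover have "antipode_lin N (f + g) = antipode_lin N f + antipode_lin N g"
      using f that unfolding H_eq by (rule lin_add)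
    ultimately show ?thesis using f that by (simp add: antipode_def del: plus_fun_apply)
  qed
  show "antipode N (smult c f) = smult c (antipode N f)"
    using f fs_smult[OF fs] by (simp add: antipode_def H_eq lin_smult)
  have "mu (tmap (antipode N) id (Delta N f)) = lin (\<lambda>m. if m = [] then one else 0) f"
    unfolding mu_tmap_Delta[OF f]
  proof (rule lin_cong)
    fix m assume m: "m \<in> supp f"
    have "lin (\<lambda>p. amult (antipode N (monom (fst p))) (id (monom (snd p)))) (Dmon N m) =
      lin (\<lambda>p. amult (anti (antipode_gen N) (fst p)) (monom (snd p))) (Dmon N m)"
      using bi[OF m] by (intro lin_cong) (simp add: antipode_monom)
    then show "lin (\<lambda>p. amult (antipode N (monom (fst p))) (id (monom (snd p)))) (Dmon N m) =
        (if m = [] then one else 0)"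
      using lin_Dmon_left[OF valid[OF m]] by simp
  qed
  then show "mu (tmap (antipode N) id (Delta N f)) = smult (eps f) one"
    using lin_unit[OF fs] by simp
  have "mu (tmap id (antipode N) (Delta N f)) = lin (\<lambda>m. if m = [] then one else 0) f"
    unfolding mu_tmap_Delta[OF f]
  proof (rule lin_cong)
    fix m assume m: "m \<in> supp f"
    have "lin (\<lambda>p. amult (id (monom (fst p))) (antipode N (monom (snd p)))) (Dmon N m) =
      lin (\<lambda>p. amult (monom (fst p)) (anti (antipode_gen N) (snd p))) (Dmon N m)"
      using bi[OF m] by (intro lin_cong) (simp add: antipode_monom)
    then show "lin (\<lambda>p. amult (id (monom (fst p))) (antipode N (monom (snd p)))) (Dmon N m) =
        (if m = [] then one else 0)"
      using lin_Dmon_right[OF valid[OF m]] by simp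
  qed
  then show "mu (tmap id (antipode N) (Delta N f)) = smult (eps f) one"
    using lin_unit[OF fs] by simp
qed

section \<open>Uniqueness of the antipode\<close>

lemma antipode_expand:
  assumes "is_antipode N S" and "f \<in> H N"
  shows "S f = lin (\<lambda>m. S (monom m)) f"
proof -
  have S_add: "S (f + g) = S f + S g" if "f \<in> H N" "g \<in> H N" for f g
    using assms(1) that by (simp add: is_antipode_def)
  have S_smult: "S (smult c f) = smult c (S f)" if "f \<in> H N" for c f
    using assms(1) that by (simp add: is_antipode_def)
  have S_zero: "S 0 = 0" using S_smult[of 0 0] by (simp add: H_eq del: zero_fun_apply)
  have valid: "supp f \<subseteq> valid N" using assms(2) by (simp add: H_eq fs_def)
  have sum: "S (\<Sum>m \<in> A. smult (f m) (delta m)) = (\<Sum>m \<in> A. smult (f m) (S (delta m)))"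
    if "A \<subseteq> valid N" for A
    using that
  proof (induction A rule: infinite_finite_induct)
    case (insert m A)
    then have "delta m \<in> H N" and "(\<Sum>m \<in> A. smult (f m) (delta m)) \<in> H N"
      unfolding H_eq by (auto intro!: fs_sum fs_smult fs_delta)
    with insert show ?case
      by (simp add: S_add S_smult H_eq fs_smult del: plus_fun_apply)
  qed (simp_all add: S_zero del: zero_fun_apply)
  have "f = lin delta f" using assms(2) by (simp add: H_eq lin_delta_id)
  then have "S f = S (lin delta f)" by simp
  also have "\<dots> = lin (\<lambda>m. S (monom m)) f"
    using sum[OF valid] by (simp add: lin_def monom_delta)
  finally show ?thesis .
qed

text \<open>As \<open>\<Delta> m = m \<otimes> 1 + \<dots>\<close> with left factors of smaller degree in the remaining terms,
  the antipode equation determines the value at \<open>m\<close> by recursion on the degree.\<close>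

lemma antipode_unique_monom:
  assumes "is_antipode N S" and "is_antipode N S'" and "m \<in> valid N"
  shows "S (monom m) = S' (monom m)"
  using assms(3)
proof (induction "deg m" arbitrary: m rule: less_induct)
  case less
  let ?D = "Dmon N m"
  let ?C = "\<lambda>S p. amult (S (monom (fst p))) (monom (snd p))"
  \<comment> \<open>The part of the antipode equation without the term m \<otimes> 1, whose
    coefficient is 1.\<close>
  define R where "R S = (\<Sum>p \<in> supp ?D - {(m, [])}. smult (?D p) (?C S p))" for S
  have fs: "?D \<in> fs (bideg N (deg m))" using less.prems by (rule fs_Dmon)
  have m: "?D (m, []) = 1" using less.prems by (simp add: Dmon_Nil)
  have mH: "monom m \<in> H N" using less.prems by (simp add: H_eq monom_delta fs_delta)
  have eq: "S (monom m) + R S = smult (eps (monom m)) one" if "is_antipode N S" for S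
  proof -
    have "smult (eps (monom m)) one = mu (tmap S id (Delta N (monom m)))"
      using that mH by (simp add: is_antipode_def)
    also have "\<dots> = lin (?C S) ?D"
      unfolding mu_tmap_Delta[OF mH] by (simp add: monom_delta)
    also have "\<dots> = smult (?D (m, [])) (?C S (m, [])) + R S"
      unfolding lin_def R_def using fs m by (intro sum.remove) (auto simp: fs_def, simp add: supp_def)
    finally show ?thesis using m by (simp add: one_def[symmetric] del: plus_fun_apply)
  qed
  have "R S = R S'"
    unfolding R_def
  proof (intro sum.cong refl)
    fix p assume p: "p \<in> supp ?D - {(m, [])}"
    then have "p \<in> bideg N (deg m)" using fs by (auto simp: fs_def)
    then have valid: "fst p \<in> valid N" "snd p \<in> valid N" "deg (fst p) + deg (snd p) = deg m"
      by (auto simp: bideg_def)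
    \<comment> \<open>A right factor 1 would force the left factor \<open>m\<close>, the term
      already removed; so the right factor has positive degree.\<close>
    have "snd p \<noteq> []"
    proof
      assume "snd p = []"
      then have "?D p = (if fst p = m then 1 else 0)"
        using Dmon_Nil[OF less.prems, of "fst p"] by (metis prod.collapse)
      with p \<open>snd p = []\<close> show False by (auto simp: supp_def prod_eq_iff split: if_splits)
    qed
    then have "deg (fst p) < deg m" using deg_pos[OF valid(2)] valid(3) by simp
    then show "smult (?D p) (?C S p) = smult (?D p) (?C S' p)"
      using less.hyps valid(1) by simp
  qed
  with eq[OF assms(1)] eq[OF assms(2)] show ?case by (metis add_right_cancel)
qed

lemma S_H_eq: "S_H N = antipode N"
  unfolding S_H_def
proof (rule the_equality)
  show "is_antipode N (antipode N) \<and> (\<forall>f. f \<notin> H N \<longrightarrow> antipode N f = 0)"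
    using is_antipode_antipode by (simp add: antipode_def del: zero_fun_apply)
next
  fix S assume S: "is_antipode N S \<and> (\<forall>f. f \<notin> H N \<longrightarrow> S f = 0)"
  show "S = antipode N"
  proof
    fix f
    show "S f = antipode N f"
    proof (cases "f \<in> H N")
      case True
      then have "supp f \<subseteq> valid N" by (simp add: H_eq fs_def)
      then have "lin (\<lambda>m. S (monom m)) f = lin (\<lambda>m. antipode N (monom m)) f"
        using S is_antipode_antipode by (intro lin_cong antipode_unique_monom) auto
      then show ?thesis
        using antipode_expand[OF _ True] S is_antipode_antipode by metis
    next
      case False
      then show ?thesis using S by (simp add: antipode_def del: zero_fun_apply)
    qed
  qed
qed

section \<open>Tree weights as signed monomials, and the formula\<close>

text \<open>Reducedness gives lower indices of length at least 2, so every inner vertex contributes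
  a true generator and not a scalar.\<close>

lemma tree_weight_lamw:
  assumes "reduced T"
  shows "tree_weight (\<lambda>i v X. amult (gen_elt i v) X) (\<lambda>a b. amult b a) one T =
    smult ((-1) ^ nv T) (monom (lamw T))"
  using assms
proof (induction T)
  case (Node c ts)
  let ?w = "tree_weight (\<lambda>i v X. amult (gen_elt i v) X) (\<lambda>a b. amult b a) one"
  show ?case
  proof (cases ts)
    case Nil
    then show ?thesis by (simp add: one_def)
  next
    case (Cons t ts')
    \<comment> \<open>Folding with the opposite product multiplies the subtrees from right to left,
      which is the \<open>rev\<close> in \<open>lamw\<close>.\<close>
    have prod: "foldr (\<lambda>a b. amult b a) (map ?w xs) one =
        smult ((-1) ^ sum_list (map nv xs)) (delta (concat (map lamw (rev xs))))"
      if "set xs \<subseteq> set ts" for xs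
      using that Node
      by (induction xs) (auto simp: one_delta amult_smult_left amult_smult_right amult_delta monom_delta power_add mult.commute)
    have long: "2 \<le> length (map root ts)" using Node.prems by (auto simp: Cons)
    have "?w (Node c ts) = - amult (gen_elt c (map root ts)) (foldr (\<lambda>a b. amult b a) (map ?w ts) one)"
      by (simp add: tree_weight_Node Cons)
    also have "\<dots> = - smult ((-1) ^ sum_list (map nv ts))
        (delta ((c, map root ts) # concat (map lamw (rev ts))))"
      by (simp only: prod[OF subset_refl] gen_elt_long[OF long] amult_smult_right amult_delta append.simps)
    also have "\<dots> = smult ((-1) ^ nv (Node c ts)) (monom (lamw (Node c ts)))"
      by (auto simp: Cons monom_delta smult_def)
    finally show ?thesis .
  qed
qed

theorem theorem7:
  fixes N i :: nat and u :: "nat list"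
  assumes "1 \<le> N" and "i \<in> {1..N}" and "set u \<subseteq> {1..N}" and "2 \<le> length u"
  shows "S_L N (Yel i u) = (\<Sum>T \<in> RT N i u. smult ((-1) ^ nv T) (monom (lamw T)))"
proof -
  have Y: "Yel i u = gen_elt i u" using assms(4) by (auto simp: gen_elt_def)
  have H: "inverse_gen N i u \<in> H N" by (simp add: H_eq fs_inverse_gen)
  have eq: "antipode N (inverse_gen N i u) = Yel i u"
    using H by (simp add: antipode_def Y antipode_lin_inverse_gen[OF assms(2,3)])
  have "S_L N (Yel i u) = inverse_gen N i u"
    unfolding S_L_def S_H_eq
  proof (rule the_equality)
    \<comment> \<open>Uniqueness of the preimage: \<open>inverse_lin\<close> cancels
      \<open>antipode_lin\<close> on both sides.\<close>
    fix x assume x: "x \<in> H N \<and> antipode N x = Yel i u"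
    then have "antipode_lin N x = antipode_lin N (inverse_gen N i u)"
      using eq H by (metis antipode_def)
    then show "x = inverse_gen N i u"
      using x H inverse_lin_antipode_lin unfolding H_eq by metis
  qed (use H eq in simp)
  also have "\<dots> = (\<Sum>T \<in> RT N i u. smult ((-1) ^ nv T) (monom (lamw T)))"
    unfolding inverse_gen_def tree_sum_def by (intro sum.cong refl tree_weight_lamw) (simp add: RT_def)
  finally show ?thesis .
qed

end
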